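(* Let $\alpha\in\mathbb{R}$ and $r>0$ be such that there are relatively prime $a,b\in\mathbb{Z}$ and $s>0$ with $e^{\frac{\pi \mathrm{i}}{2}\alpha} = \frac1s\left(\frac{a}{r}+\mathrm{i}br\right)$ (so $s=\sqrt{(a/r)^2+(br)^2}$). Let $c,d\in\mathbb{Z}$ be such that $ad-bc=1$, and let $t = \frac{ac}{r^2}+bdr^2$. Then there exists $\mu_0\in\mathbb{C}\setminus\{0\}$ such that, as tempered distributions, $$\mathcal{F}^\alpha Ш_r(x) = \mu_0\, e^{-\pi \mathrm{i} t x^2-\pi \mathrm{i} cdsx}\,Ш_{1/s}\!\left(x-\frac{ab}{2s}\right).$$
   Context: For $r>0$, the Dirac comb is the tempered distribution $Ш_r(x) = \sqrt{r}\sum_{k\in\mathbb{Z}}\delta(x-rk)\in\mathscr{S}'(\mathbb{R})$. Fractional Fourier transform: for $\alpha\in(-2,2)\setminus\{0\}$ and $f\in\mathscr{S}(\mathbb{R})$, $$\mathcal{F}^\alpha f(x) = \frac{1}{\sqrt{\mathrm{i}\sin(\pi\alpha/2)}}\int e^{\frac{\pi \mathrm{i}}{\sin(\pi\alpha/2)}(\cos(\pi\alpha/2)(x^2+y^2)-2xy)}f(y)\,dy,$$ with the square root having positive real part; $\mathcal{F}^0 f=f$; and $\mathcal{F}^2f(x) = -\mathrm{i}f(-x)$, so that the definition extends to all real exponents by $\mathcal{F}^{\alpha+2k}f(x) = e^{-\frac{\pi \mathrm{i}}{2}k}\mathcal{F}^\alpha f((-1)^kx)$ for $k\in\mathbb{Z}$,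 $\alpha\in(-2,2)$. Each $\mathcal{F}^\alpha$ is an automorphism of $\mathscr{S}(\mathbb{R})$ and extends (weakly continuously) to $\mathscr{S}'(\mathbb{R})$. *)

theory Defs
  imports "HOL-Analysis.Analysis"
begin

section \<open>Schwartz functions and tempered distributions on the real line\<close>

definition vderiv :: "(real \<Rightarrow> complex) \<Rightarrow> real \<Rightarrow> complex" where
  "vderiv f = (\<lambda>x. vector_derivative f (at x))"

definition schwartz :: "(real \<Rightarrow> complex) set" where
  "schwartz = {f. (\<forall>n x. (vderiv ^^ n) f differentiable (at x)) \<and>
                  (\<forall>j n. bounded (range (\<lambda>x. x ^ j *\<^sub>R (vderiv ^^ n) f x)))}"

definition schwartz_seminorm :: "nat \<Rightarrow> nat \<Rightarrow> (real \<Rightarrow> complex) \<Rightarrow> real" where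
  "schwartz_seminorm j n f = (SUP x. norm (x ^ j *\<^sub>R (vderiv ^^ n) f x))"

text \<open>
  A distribution is represented by a functional on all functions \<open>real \<Rightarrow> complex\<close> of which only
  the values on \<open>schwartz\<close> matter. Continuity is with respect to the locally convex topology
  generated by the seminorms above.
\<close>

type_synonym functional = "(real \<Rightarrow> complex) \<Rightarrow> complex"

definition tempered_distribution :: "functional \<Rightarrow> bool" where
  "tempered_distribution u \<longleftrightarrow>
     (\<forall>f\<in>schwartz. \<forall>g\<in>schwartz. \<forall>p q. u (\<lambda>x. p * f x + q * g x) = p * u f + q * u g) \<and>
     (\<forall>f\<in>schwartz. \<forall>\<epsilon>>0. \<exists>\<delta>>0. \<exists>N. \<forall>g\<in>schwartz.
        (\<forall>j\<le>N. \<forall>n\<le>N. schwartz_seminorm j n (\<lambda>x. g x - f x) < \<delta>) \<longrightarrow> norm (u g - u f) < \<epsilon>)"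

definition tempered_eq :: "functional \<Rightarrow> functional \<Rightarrow> bool" where
  "tempered_eq u v \<longleftrightarrow>
     tempered_distribution u \<and> tempered_distribution v \<and> (\<forall>\<phi>\<in>schwartz. u \<phi> = v \<phi>)"

definition delta :: "real \<Rightarrow> functional" where
  "delta p \<phi> = \<phi> p"

definition dirac_comb :: "real \<Rightarrow> functional" where
  "dirac_comb r \<phi> = complex_of_real (sqrt r) * (\<Sum>\<^sub>\<infinity>k::int. delta (r * of_int k) \<phi>)"

text \<open>\<open>mult_dist g u\<close> is \<open>g(x) u(x)\<close>, and \<open>translate_dist h u\<close> is \<open>u(x - h)\<close>.\<close>

definition mult_dist :: "(real \<Rightarrow> complex) \<Rightarrow> functional \<Rightarrow> functional" where
  "mult_dist g u \<phi> = u (\<lambda>x. g x * \<phi> x)"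

definition translate_dist :: "real \<Rightarrow> functional \<Rightarrow> functional" where
  "translate_dist h u \<phi> = u (\<lambda>x. \<phi> (x + h))"

section \<open>The fractional Fourier transform\<close>

definition frft_kernel :: "real \<Rightarrow> real \<Rightarrow> real \<Rightarrow> complex" where
  "frft_kernel \<alpha> x y =
     exp (\<i> * complex_of_real (pi / sin (pi * \<alpha> / 2) * (cos (pi * \<alpha> / 2) * (x\<^sup>2 + y\<^sup>2) - 2 * x * y)))"

text \<open>
  The transform for exponents in \<open>(-2, 2)\<close>. The principal root \<open>csqrt\<close> of a nonzero
  imaginary number has positive real part.
\<close>

definition frft_base :: "real \<Rightarrow> (real \<Rightarrow> complex) \<Rightarrow> real \<Rightarrow> complex" where
  "frft_base \<alpha> f x =
     (if \<alpha> = 0 then f x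
      else 1 / csqrt (\<i> * complex_of_real (sin (pi * \<alpha> / 2))) *
             (LBINT y. frft_kernel \<alpha> x y * f y))"

text \<open>
  An arbitrary exponent is written as \<open>\<beta> + 2 k\<close> with \<open>\<beta> \<in> (-2, 2)\<close>, where \<open>k\<close> is \<open>\<alpha> / 2\<close> rounded
  towards zero. By \<open>frft_add_even\<close> below, every other admissible \<open>k\<close> gives the same result.
\<close>

definition frft_shift :: "real \<Rightarrow> int" where
  "frft_shift \<alpha> = (if \<alpha> \<ge> 0 then \<lfloor>\<alpha> / 2\<rfloor> else \<lceil>\<alpha> / 2\<rceil>)"

definition frft :: "real \<Rightarrow> (real \<Rightarrow> complex) \<Rightarrow> real \<Rightarrow> complex" where
  "frft \<alpha> f x = (let k = frft_shift \<alpha> in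
     exp (- (\<i> * of_real pi / 2 * of_int k)) * frft_base (\<alpha> - 2 * of_int k) f ((- 1) powi k * x))"

text \<open>
  The transform of integrable functions is symmetric for the bilinear pairing
  (\<open>frft_symmetric\<close> below), so its weakly continuous extension to tempered distributions is its transpose.
\<close>

definition frft_dist :: "real \<Rightarrow> functional \<Rightarrow> functional" where
  "frft_dist \<alpha> u \<phi> = u (frft \<alpha> \<phi>)"

lemma frft_shift_zero: "\<bar>\<alpha>\<bar> < 2 \<Longrightarrow> frft_shift \<alpha> = 0"
  unfolding frft_shift_def by (auto simp: floor_eq_iff ceiling_eq_iff)

lemma frft_shift_bound: "\<bar>\<alpha> - 2 * of_int (frft_shift \<alpha>)\<bar> < 2"
proof -
  have "of_int \<lfloor>\<alpha> / 2\<rfloor> \<le> \<alpha> / 2" "\<alpha> / 2 < of_int \<lfloor>\<alpha> / 2\<rfloor> + 1"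
    "\<alpha> / 2 \<le> of_int \<lceil>\<alpha> / 2\<rceil>" "of_int \<lceil>\<alpha> / 2\<rceil> - 1 < \<alpha> / 2"
    by linarith+
  then show ?thesis unfolding frft_shift_def by (cases "\<alpha> \<ge> 0") (simp, linarith)+
qed

lemma frft_eq_base: "\<bar>\<alpha>\<bar> < 2 \<Longrightarrow> frft \<alpha> f x = frft_base \<alpha> f x"
  by (simp add: frft_def frft_shift_zero)

lemma csqrt_minus_ii:
  assumes "\<sigma> > 0"
  shows "csqrt (- (\<i> * of_real \<sigma>)) = - \<i> * csqrt (\<i> * of_real \<sigma>)"
proof (rule csqrt_unique)
  show "(- \<i> * csqrt (\<i> * of_real \<sigma>))\<^sup>2 = - (\<i> * of_real \<sigma>)"
    by (simp add: power_mult_distrib)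
  show "0 < Re (- \<i> * csqrt (\<i> * of_real \<sigma>)) \<or>
        Re (- \<i> * csqrt (\<i> * of_real \<sigma>)) = 0 \<and> 0 \<le> Im (- \<i> * csqrt (\<i> * of_real \<sigma>))"
    using assms by (simp add: csqrt.simps norm_mult)
qed

lemma frft_base_add2:
  assumes "-2 < \<alpha>" "\<alpha> < 0"
  shows "frft_base (\<alpha> + 2) f x = - \<i> * frft_base \<alpha> f (- x)"
proof -
  define \<sigma> where "\<sigma> = - sin (pi * \<alpha> / 2)"
  have "pi * (- \<alpha>) < pi * 2" using assms by (intro mult_strict_left_mono) auto
  then have "sin (pi * (- \<alpha>) / 2) > 0"
    using assms by (intro sin_gt_zero) (auto simp: mult_less_0_iff)
  then have pos: "\<sigma> > 0" by (simp add: \<sigma>_def)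
  have arg: "pi * (\<alpha> + 2) / 2 = pi * \<alpha> / 2 + pi" by (simp add: field_simps)
  have s2: "sin (pi * (\<alpha> + 2) / 2) = \<sigma>" and c2: "cos (pi * (\<alpha> + 2) / 2) = - cos (pi * \<alpha> / 2)"
    unfolding arg by (simp_all add: \<sigma>_def)
  have s1: "sin (pi * \<alpha> / 2) = - \<sigma>" by (simp add: \<sigma>_def)
  have ker: "frft_kernel (\<alpha> + 2) x y = frft_kernel \<alpha> (- x) y" for y
  proof -
    have "pi / \<sigma> * (- cos (pi * \<alpha> / 2) * (x\<^sup>2 + y\<^sup>2) - 2 * x * y) =
          pi / (- \<sigma>) * (cos (pi * \<alpha> / 2) * ((- x)\<^sup>2 + y\<^sup>2) - 2 * (- x) * y)"
      using pos by (simp add: field_simps)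
    then show ?thesis unfolding frft_kernel_def s2 c2 s1 by (rule arg_cong)
  qed
  have root: "1 / csqrt (\<i> * of_real \<sigma>) = - \<i> * (1 / csqrt (- (\<i> * of_real \<sigma>)))"
    unfolding csqrt_minus_ii[OF pos] by (simp add: field_simps)
  show ?thesis
    using assms unfolding frft_base_def s2 s1 ker by (simp add: root)
qed

lemma exp_half_pi_shift:
  "exp (- (\<i> * of_real pi / 2 * of_int (k + 1))) = - \<i> * exp (- (\<i> * of_real pi / 2 * of_int k))"
proof -
  have *: "exp (- (\<i> * of_real pi / 2)) = - \<i>"
    by (simp add: exp_eq_polar complex_eq_iff)
  show ?thesis
    unfolding *[symmetric] mult_exp_exp by (rule arg_cong[where f = exp]) (simp add: field_simps)
qed

theorem frft_add_even:
  assumes "\<bar>\<alpha>\<bar> < 2"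
  shows "frft (\<alpha> + 2 * of_int k) f x =
           exp (- (\<i> * of_real pi / 2 * of_int k)) * frft \<alpha> f ((- 1) powi k * x)"
proof -
  have gen: "exp (- (\<i> * of_real pi / 2 * of_int (m + 1))) * frft_base \<beta> f ((- 1) powi (m + 1) * x) =
             exp (- (\<i> * of_real pi / 2 * of_int m)) * frft_base (\<beta> + 2) f ((- 1) powi m * x)"
    if "\<bar>\<beta>\<bar> < 2" "\<bar>\<beta> + 2\<bar> < 2" for m \<beta>
  proof -
    have "-2 < \<beta>" "\<beta> < 0" using that by auto
    then have "frft_base (\<beta> + 2) f ((- 1) powi m * x) = - \<i> * frft_base \<beta> f (- ((- 1) powi m * x))"
      by (rule frft_base_add2)
    moreover have "(- 1) powi (m + 1) * x = - ((- 1) powi m * x)"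
      by (simp add: power_int_add)
    ultimately show ?thesis unfolding exp_half_pi_shift by simp
  qed
  define \<gamma> where "\<gamma> = \<alpha> + 2 * of_int k"
  define l where "l = frft_shift \<gamma>"
  define \<beta> where "\<beta> = \<gamma> - 2 * of_int l"
  have b: "\<bar>\<beta>\<bar> < 2" using frft_shift_bound[of \<gamma>] by (simp add: \<beta>_def l_def)
  have ab: "\<beta> = \<alpha> + 2 * of_int (k - l)" by (simp add: \<beta>_def \<gamma>_def)
  define m where "m = k - l"
  have "\<bar>real_of_int m\<bar> < 2" using b assms unfolding ab m_def[symmetric] by linarith
  then have "m = 0 \<or> m = 1 \<or> m = - 1" by linarith
  then have "exp (- (\<i> * of_real pi / 2 * of_int l)) * frft_base \<beta> f ((- 1) powi l * x) =
             exp (- (\<i> * of_real pi / 2 * of_int k)) * frft_base \<alpha> f ((- 1) powi k * x)"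
  proof (elim disjE)
    assume "m = 0"
    then have "l = k" "\<beta> = \<alpha>" using ab by (simp_all add: m_def)
    then show ?thesis by simp
  next
    assume "m = 1"
    then have k: "k = l + 1" and \<beta>: "\<beta> = \<alpha> + 2" using ab by (simp_all add: m_def)
    show ?thesis unfolding k \<beta> by (rule gen[symmetric]) (use assms b \<beta> in auto)
  next
    assume "m = - 1"
    then have l: "l = k + 1" and \<alpha>: "\<alpha> = \<beta> + 2" using ab by (simp_all add: m_def)
    show ?thesis unfolding l \<alpha> by (rule gen) (use assms b \<alpha> in auto)
  qed
  moreover have "frft \<gamma> f x = exp (- (\<i> * of_real pi / 2 * of_int l)) * frft_base \<beta> f ((- 1) powi l * x)"
    by (simp add: frft_def Let_def l_def \<beta>_def)
  ultimately show ?thesis by (simp add: frft_eq_base[OF assms] \<gamma>_def)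
qed

lemma frft_kernel_sym: "frft_kernel \<alpha> x y = frft_kernel \<alpha> y x"
  by (simp add: frft_kernel_def algebra_simps)

lemma frft_kernel_minus: "frft_kernel \<alpha> (- x) y = frft_kernel \<alpha> x (- y)"
  by (simp add: frft_kernel_def)

lemma norm_frft_kernel: "norm (frft_kernel \<alpha> x y) = 1"
  unfolding frft_kernel_def by (rule norm_exp_i_times)

lemma frft_base_symmetric:
  assumes f: "integrable lborel f" and g: "integrable lborel g"
  shows "(LBINT x. frft_base \<alpha> f x * g x) = (LBINT x. f x * frft_base \<alpha> g x)"
proof (cases "\<alpha> = 0")
  case True
  then show ?thesis by (simp add: frft_base_def)
next
  case False
  have [measurable]: "f \<in> borel_measurable borel" "g \<in> borel_measurable borel"
    using f g by auto
  have prod: "integrable (lborel \<Otimes>\<^sub>M lborel) (\<lambda>(x, y). g x * f y)"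
  proof (rule lborel_pair.Fubini_integrable)
    show "integrable lborel (\<lambda>x. LBINT y. norm (case (x, y) of (x, y) \<Rightarrow> g x * f y))"
      using g by (simp add: norm_mult)
    show "AE x in lborel. integrable lborel (\<lambda>y. case (x, y) of (x, y) \<Rightarrow> g x * f y)"
      using f by simp
  qed measurable
  have "integrable (lborel \<Otimes>\<^sub>M lborel) (\<lambda>(x, y). frft_kernel \<alpha> x y * (g x * f y))"
  proof (rule Bochner_Integration.integrable_bound[OF prod])
    have [measurable]: "(\<lambda>(x, y). frft_kernel \<alpha> x y) \<in> borel_measurable (lborel \<Otimes>\<^sub>M lborel)"
      unfolding frft_kernel_def by measurable
    show "(\<lambda>(x, y). frft_kernel \<alpha> x y * (g x * f y)) \<in> borel_measurable (lborel \<Otimes>\<^sub>M lborel)"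
      by measurable
  qed (auto simp: norm_mult norm_frft_kernel)
  from lborel_pair.Fubini_integral[OF this]
  have "(LBINT y. LBINT x. frft_kernel \<alpha> x y * (g x * f y)) =
        (LBINT x. LBINT y. frft_kernel \<alpha> x y * (g x * f y))" .
  moreover have "(LBINT y. frft_kernel \<alpha> x y * (g x * f y)) = (LBINT y. frft_kernel \<alpha> x y * f y) * g x" for x
  proof -
    have "frft_kernel \<alpha> x y * (g x * f y) = frft_kernel \<alpha> x y * f y * g x" for y by simp
    then show ?thesis by (simp only: integral_mult_left_zero)
  qed
  moreover have "(LBINT x. frft_kernel \<alpha> x y * (g x * f y)) = f y * (LBINT x. frft_kernel \<alpha> y x * g x)" for y
  proof -
    have "frft_kernel \<alpha> x y * (g x * f y) = f y * (frft_kernel \<alpha> y x * g x)" for x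
      by (simp add: frft_kernel_sym[of \<alpha> x y])
    then show ?thesis by (simp only: integral_mult_right_zero)
  qed
  ultimately have "(LBINT x. (LBINT y. frft_kernel \<alpha> x y * f y) * g x) =
        (LBINT x. f x * (LBINT y. frft_kernel \<alpha> x y * g y))" by simp
  then show ?thesis using False by (simp add: frft_base_def)
qed

theorem frft_symmetric:
  assumes f: "integrable lborel f" and g: "integrable lborel g"
  shows "(LBINT x. frft \<alpha> f x * g x) = (LBINT x. f x * frft \<alpha> g x)"
proof -
  define k where "k = frft_shift \<alpha>"
  define \<beta> where "\<beta> = \<alpha> - 2 * of_int k"
  define z where "z = exp (- (\<i> * complex_of_real pi / 2 * of_int k))"
  have fr: "frft \<alpha> h x = z * frft_base \<beta> h ((- 1) powi k * x)" for h x
    by (simp add: frft_def Let_def k_def \<beta>_def z_def)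
  have reflect: "(LBINT x. h x) = (LBINT x. h (- x))" for h :: "real \<Rightarrow> complex"
    using lborel_integral_real_affine[of "-1" h 0] by simp
  have base_reflect: "frft_base \<beta> h (- x) = frft_base \<beta> (\<lambda>y. h (- y)) x" for h x
    using reflect[of "\<lambda>y. frft_kernel \<beta> x (- y) * h y"]
    by (simp add: frft_base_def frft_kernel_minus)
  have int': "integrable lborel (\<lambda>x. f (- x))"
    using lborel_integrable_real_affine[OF f, of "-1" 0] by simp
  have "(LBINT x. frft_base \<beta> f ((- 1) powi k * x) * g x) =
        (LBINT x. f x * frft_base \<beta> g ((- 1) powi k * x))"
  proof (cases "even k")
    case True
    then show ?thesis using frft_base_symmetric[OF f g] by simp
  next
    case False
    then show ?thesis
      using frft_base_symmetric[OF int' g] reflect[of "\<lambda>x. f x * frft_base \<beta> g (- x)"]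
      by (simp add: base_reflect)
  qed
  then show ?thesis by (simp add: fr mult.assoc mult.left_commute[of _ z])
qed

end

theory Submission
  imports Defs "HOL-Probability.Sinc_Integral"
begin


text \<open>
  The case \<open>b = 0\<close> is elementary: \<open>\<alpha>\<close> is then an even integer, the transform is the identity or the
  reflection up to a constant, and the exponential factor is \<open>1\<close> on the lattice (\<open>frft_comb_sin_zero\<close>).

  Let \<open>b \<noteq> 0\<close>. At the lattice point \<open>r n\<close> the kernel of the transform factors as
  \<open>exp (\<pi> i a n\<^sup>2 / b)\<close> times a chirp \<open>exp (\<pi> i a y\<^sup>2 / (b r\<^sup>2))\<close> times the ordinary Fourier character of
  frequency \<open>s n / b\<close>. Pairing the transform of the comb with \<open>\<phi>\<close> therefore gives, up to a constant,
  \<open>\<Sum>n. exp (\<pi> i a n\<^sup>2 / b) g^(s n / b)\<close>, where \<open>g\<close> is \<open>\<phi>\<close> times the chirp and \<open>g^\<close> is its Fourier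
  transform. The weights are periodic mod \<open>b\<close> up to the sign \<open>(-1)^(a b)\<close>. On each residue class the
  sum is thus a twisted lattice sum of \<open>g^\<close>, and Poisson summation turns it into a sum of values of
  \<open>g\<close> at the points \<open>y k = (k + a b / 2) / s\<close>, with the twist appearing as the shift \<open>a b / 2\<close>.
  Adding the classes leaves the coefficient \<open>S k\<close>, a quadratic Gauss sum over the residues mod \<open>b\<close>
  (\<open>sum_chirp_fourier\<close>).

  Since \<open>a d\<close> is \<open>1\<close> mod \<open>b\<close>, translating the summation variable by \<open>d k\<close> completes the square, so
  \<open>S k\<close> is \<open>S 0\<close> times an explicit quadratic phase in \<open>k\<close> (\<open>chirp_gauss_sum_eq\<close>). That phase and the
  chirp of \<open>g\<close> combine at \<open>y k\<close> to the exponential factor of the theorem, up to a constant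
  (\<open>half_char_completed_square\<close>). The constant does not vanish because \<open>S 0 = 0\<close> would make all \<open>S k\<close>
  vanish, while their sum over a period is \<open>\<bar>b\<bar>\<close> (\<open>chirp_gauss_sum_nonzero\<close>).

  Poisson summation is proved for twice differentiable functions that decay like \<open>1 / (1 + x\<^sup>2)\<close>
  together with their derivatives. The partial sum of the \<open>g^(m)\<close> over \<open>\<bar>m\<bar> \<le> N\<close> is the integral of \<open>g\<close>
  against the Dirichlet kernel; on each unit interval this differs from the trapezoidal rule by an
  integral of \<open>g'\<close> against the error of the truncated Fourier series of the sawtooth, and that error
  tends to \<open>0\<close> in mean square because the sum of \<open>1 / n\<^sup>2\<close> is \<open>\<pi>\<^sup>2 / 6\<close>.
\<close>

section \<open>The Dirichlet kernel and the sawtooth\<close>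

definition dirichlet_kernel :: "nat \<Rightarrow> real \<Rightarrow> real" where
  "dirichlet_kernel N x = 1 + (\<Sum>n\<in>{1..N}. 2 * cos (2 * pi * real n * x))"

text \<open>
  The difference of \<open>x - 1/2\<close> and the \<open>N\<close>-th partial sum of its Fourier series on \<open>(0, 1)\<close>. It is the
  antiderivative of the Dirichlet kernel with the values \<open>-1/2\<close> and \<open>1/2\<close> at the ends of the period,
  so that integration by parts against it produces the trapezoidal rule.
\<close>

definition sawtooth_error :: "nat \<Rightarrow> real \<Rightarrow> real" where
  "sawtooth_error N x = x - 1/2 + (\<Sum>n\<in>{1..N}. sin (2 * pi * real n * x) / (pi * real n))"

lemma sawtooth_error_deriv:
  "(sawtooth_error N has_real_derivative dirichlet_kernel N x) (at x within S)"
proof -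
  have "((\<lambda>x. x - 1/2 + (\<Sum>n\<in>{1..N}. sin (2 * pi * real n * x) / (pi * real n))) has_real_derivative
     1 - 0 + (\<Sum>n\<in>{1..N}. 2 * cos (2 * pi * real n * x))) (at x within S)"
    by (intro derivative_intros DERIV_sum) (auto intro!: derivative_eq_intros)
  then show ?thesis
    by (simp add: dirichlet_kernel_def sawtooth_error_def[abs_def])
qed

lemma sin_cos_2pi_nat [simp]: "sin (2 * pi * real n) = 0" "cos (2 * pi * real n) = 1"
proof -
  show "sin (2 * pi * real n) = 0"
    using sin_npi2[of "2 * n"] by (simp add: mult_ac)
  show "cos (2 * pi * real n) = 1"
    using cos_npi2[of "2 * n"] by (simp add: mult_ac)
qed

lemma sawtooth_error_ends: "sawtooth_error N 0 = - 1/2" "sawtooth_error N 1 = 1/2"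
  by (simp_all add: sawtooth_error_def)

lemma dirichlet_kernel_continuous [continuous_intros]:
  fixes f :: "real \<Rightarrow> real"
  shows "continuous_on A f \<Longrightarrow> continuous_on A (\<lambda>x. dirichlet_kernel N (f x))"
  unfolding dirichlet_kernel_def by (intro continuous_intros)

lemma sawtooth_error_continuous [continuous_intros]:
  fixes f :: "real \<Rightarrow> real"
  shows "continuous_on A f \<Longrightarrow> continuous_on A (\<lambda>x. sawtooth_error N (f x))"
  unfolding sawtooth_error_def by (intro continuous_intros) auto

lemma has_integral_cos_period:
  assumes "m \<noteq> (0::int)"
  shows "((\<lambda>x. cos (2 * pi * m * x)) has_integral 0) {0..1}"
proof -
  have "((\<lambda>x. cos (2 * pi * m * x)) has_integral
      (sin (2 * pi * m * 1) / (2 * pi * m) - sin (2 * pi * m * 0) / (2 * pi * m))) {0..1}"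
    using assms
    by (intro fundamental_theorem_of_calculus)
       (auto intro!: derivative_eq_intros simp flip: has_real_derivative_iff_has_vector_derivative)
  moreover have "sin (2 * pi * real_of_int m) = 0"
    using sin_zero_iff_int2 by (metis mult.assoc mult.commute mult_2 of_int_add of_int_mult of_int_numeral)
  ultimately show ?thesis by simp
qed

text \<open>The kernel only contains frequencies up to \<open>N\<close>, which are orthogonal to frequency \<open>M > N\<close>.\<close>

lemma has_integral_dirichlet_cos:
  assumes "M > N"
  shows "((\<lambda>x. dirichlet_kernel N x * cos (2 * pi * M * x)) has_integral 0) {0..1}"
proof -
  have prod: "2 * cos (2 * pi * n * x) * cos (2 * pi * M * x) =
     cos (2 * pi * real_of_int (int n + int M) * x) + cos (2 * pi * real_of_int (int n - int M) * x)" for n x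
    using cos_add[of "2 * pi * n * x" "2 * pi * M * x"] cos_diff[of "2 * pi * n * x" "2 * pi * M * x"]
    by (simp add: ring_distribs)
  have "((\<lambda>x. cos (2 * pi * real_of_int (int M) * x) + (\<Sum>n\<in>{1..N}. cos (2 * pi * real_of_int (int n + int M) * x) +
      cos (2 * pi * real_of_int (int n - int M) * x))) has_integral 0 + (\<Sum>n\<in>{1..N}. 0 + 0)) {0..1}"
    using assms by (intro has_integral_add has_integral_sum has_integral_cos_period) auto
  moreover have "dirichlet_kernel N x * cos (2 * pi * M * x) =
     cos (2 * pi * real_of_int (int M) * x) + (\<Sum>n\<in>{1..N}. cos (2 * pi * real_of_int (int n + int M) * x) +
      cos (2 * pi * real_of_int (int n - int M) * x))" for x
    unfolding dirichlet_kernel_def prod[symmetric]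
    by (simp add: ring_distribs sum_distrib_right)
  ultimately show ?thesis by simp
qed

lemma has_integral_sawtooth_sin:
  assumes "M > N"
  shows "((\<lambda>x. sawtooth_error N x * sin (2 * pi * M * x)) has_integral - 1 / (2 * pi * M)) {0..1}"
proof -
  have M: "M > 0" using assms by simp
  let ?F = "\<lambda>x. - sawtooth_error N x * cos (2 * pi * M * x) / (2 * pi * M)"
  have "((\<lambda>x. - dirichlet_kernel N x * cos (2 * pi * M * x) / (2 * pi * M) +
       sawtooth_error N x * sin (2 * pi * M * x)) has_integral (?F 1 - ?F 0)) {0..1}"
    using M by (intro fundamental_theorem_of_calculus)
       (auto intro!: derivative_eq_intros sawtooth_error_deriv simp: field_simps
          simp flip: has_real_derivative_iff_has_vector_derivative)
  moreover have "?F 1 - ?F 0 = - 1 / (2 * pi * M)"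
    unfolding sawtooth_error_ends mult_1_right sin_cos_2pi_nat by simp
  ultimately have 1: "((\<lambda>x. - dirichlet_kernel N x * cos (2 * pi * M * x) / (2 * pi * M) +
       sawtooth_error N x * sin (2 * pi * M * x)) has_integral - 1 / (2 * pi * M)) {0..1}"
    by (simp only:)
  have 2: "((\<lambda>x. (1 / (2 * pi * M)) * (dirichlet_kernel N x * cos (2 * pi * M * x)))
      has_integral (1 / (2 * pi * M)) * 0) {0..1}"
    by (intro has_integral_mult_right has_integral_dirichlet_cos assms)
  show ?thesis
    using has_integral_add[OF 1 2] by simp
qed

lemma has_integral_sin_squared:
  assumes "M > (0::nat)"
  shows "((\<lambda>x. (sin (2 * pi * M * x))\<^sup>2) has_integral 1/2) {0..1}"
proof -
  have "(sin (2 * pi * M * x))\<^sup>2 = 1/2 - 1/2 * cos (2 * pi * int (2 * M) * x)" for x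
    using cos_double_sin[of "2 * pi * M * x"] by (simp add: mult_ac diff_divide_distrib)
  moreover have "((\<lambda>x. 1/2 - 1/2 * cos (2 * pi * int (2 * M) * x)) has_integral (1/2 - 1/2 * 0)) {0..1}"
    using has_integral_const_real[of "1/2::real" 0 1] assms
    by (intro has_integral_diff has_integral_mult_right has_integral_cos_period) auto
  ultimately show ?thesis by simp
qed

text \<open>
  This is Parseval's identity: passing from \<open>N\<close> to \<open>N + 1\<close> removes one Fourier coefficient and
  lowers the squared norm by exactly its contribution, starting from \<open>\<integral> (x - 1/2)\<^sup>2 = 1/12\<close>.
\<close>

lemma sawtooth_error_L2:
  "((\<lambda>x. (sawtooth_error N x)\<^sup>2) has_integral 1/12 - (\<Sum>n\<in>{1..N}. 1 / (2 * pi\<^sup>2 * (real n)\<^sup>2))) {0..1}"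
proof (induction N)
  case 0
  have "((\<lambda>x. (x - 1/2)\<^sup>2) has_integral ((1 - 1/2)^3/3 - (0 - 1/2)^3/3 :: real)) {0..1}"
    by (intro fundamental_theorem_of_calculus)
       (auto intro!: derivative_eq_intros simp flip: has_real_derivative_iff_has_vector_derivative)
  then show ?case by (simp add: sawtooth_error_def power3_eq_cube)
next
  case (Suc N)
  define M where "M = Suc N"
  have M: "M > 0" "M > N" by (simp_all add: M_def)
  have "((\<lambda>x. (sawtooth_error N x)\<^sup>2 + ((2 / (pi * M)) * (sawtooth_error N x * sin (2 * pi * M * x)) +
       (1 / (pi * M)\<^sup>2) * (sin (2 * pi * M * x))\<^sup>2)) has_integral
      (1/12 - (\<Sum>n\<in>{1..N}. 1 / (2 * pi\<^sup>2 * (real n)\<^sup>2))) +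
       ((2 / (pi * M)) * (- 1 / (2 * pi * M)) + (1 / (pi * M)\<^sup>2) * (1/2))) {0..1}"
    by (intro has_integral_add Suc.IH has_integral_mult_right has_integral_sawtooth_sin
          has_integral_sin_squared M)
  moreover have "(sawtooth_error (Suc N) x)\<^sup>2 = (sawtooth_error N x)\<^sup>2 +
       ((2 / (pi * M)) * (sawtooth_error N x * sin (2 * pi * M * x)) +
       (1 / (pi * M)\<^sup>2) * (sin (2 * pi * M * x))\<^sup>2)" for x
  proof -
    have "sawtooth_error (Suc N) x = sawtooth_error N x + sin (2 * pi * M * x) / (pi * M)"
      by (simp add: sawtooth_error_def M_def)
    then show ?thesis by (simp add: power2_sum power_divide)
  qed
  moreover have "(1/12 - (\<Sum>n\<in>{1..N}. 1 / (2 * pi\<^sup>2 * (real n)\<^sup>2))) +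
       ((2 / (pi * M)) * (- 1 / (2 * pi * M)) + (1 / (pi * M)\<^sup>2) * (1/2)) =
       1/12 - (\<Sum>n\<in>{1..Suc N}. 1 / (2 * pi\<^sup>2 * (real n)\<^sup>2))"
  proof -
    have "(2 / (pi * M)) * (- 1 / (2 * pi * M)) + (1 / (pi * M)\<^sup>2) * (1/2) = - (1 / (2 * pi\<^sup>2 * (real M)\<^sup>2))"
      by (simp add: power2_eq_square field_simps)
    moreover have "(\<Sum>n\<in>{1..Suc N}. 1 / (2 * pi\<^sup>2 * (real n)\<^sup>2)) =
        (\<Sum>n\<in>{1..N}. 1 / (2 * pi\<^sup>2 * (real n)\<^sup>2)) + 1 / (2 * pi\<^sup>2 * (real M)\<^sup>2)"
      by (simp add: M_def)
    ultimately show ?thesis by simp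
  qed
  ultimately show ?case by (simp only:)
qed

text \<open>
  The squared norms tend to \<open>1/12 - (\<pi>\<^sup>2 / 6) / (2 \<pi>\<^sup>2) = 0\<close> by Euler's evaluation of the sum of
  \<open>1 / n\<^sup>2\<close>; convergence in mean square on a bounded interval implies convergence in mean.
\<close>

lemma sawtooth_error_L1_tendsto_0:
  "(\<lambda>N. integral {0..1} (\<lambda>x. \<bar>sawtooth_error N x\<bar>)) \<longlonglongrightarrow> 0"
proof -
  define I where "I N = 1/12 - (\<Sum>n\<in>{1..N}. 1 / (2 * pi\<^sup>2 * (real n)\<^sup>2))" for N
  have "(\<lambda>N. \<Sum>n<N. 1 / (real n + 1)\<^sup>2) \<longlonglongrightarrow> pi\<^sup>2 / 6"
    using inverse_squares_sums by (simp add: sums_def add.commute)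
  then have "(\<lambda>N. 1/12 - 1 / (2 * pi\<^sup>2) * (\<Sum>n<N. 1 / (real n + 1)\<^sup>2)) \<longlonglongrightarrow> 1/12 - 1 / (2 * pi\<^sup>2) * (pi\<^sup>2 / 6)"
    by (intro tendsto_intros)
  moreover have "(\<Sum>n\<in>{1..N}. 1 / (2 * pi\<^sup>2 * (real n)\<^sup>2)) = 1 / (2 * pi\<^sup>2) * (\<Sum>n<N. 1 / (real n + 1)\<^sup>2)" for N
    unfolding sum_distrib_left
    by (rule sum.reindex_bij_witness[of _ Suc "\<lambda>n. n - 1"]) (auto simp: add.commute)
  ultimately have I0: "I \<longlonglongrightarrow> 0"
    by (simp add: I_def[abs_def])
  \<comment> \<open>The summand \<open>1 / (N + 1)\<close> only serves to make \<open>\<delta> N\<close> positive, so that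
    \<open>\<bar>v\<bar> \<le> (\<delta> N + v\<^sup>2 / \<delta> N) / 2\<close> can be used to compare the two norms.\<close>
  define \<delta> where "\<delta> N = sqrt (I N) + 1 / real (Suc N)" for N
  have "\<delta> \<longlonglongrightarrow> sqrt 0 + 0"
    unfolding \<delta>_def using I0 LIMSEQ_inverse_real_of_nat by (intro tendsto_intros) (auto simp: inverse_eq_divide)
  then have lim: "\<delta> \<longlonglongrightarrow> 0" by simp
  have bnd: "integral {0..1} (\<lambda>x. \<bar>sawtooth_error N x\<bar>) \<le> \<delta> N" for N
  proof -
    have L2: "((\<lambda>x. (sawtooth_error N x)\<^sup>2) has_integral I N) {0..1}"
      unfolding I_def by (rule sawtooth_error_L2)
    have "I N \<ge> 0" using has_integral_nonneg[OF L2] by simp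
    then have d: "\<delta> N > 0" "I N \<le> (\<delta> N)\<^sup>2"
      by (auto simp: \<delta>_def power2_sum intro!: add_nonneg_pos add_increasing2)
    have "((\<lambda>x. \<delta> N / 2 + 1 / (2 * \<delta> N) * (sawtooth_error N x)\<^sup>2) has_integral
        \<delta> N / 2 + 1 / (2 * \<delta> N) * I N) {0..1}"
      using has_integral_const_real[of "\<delta> N / 2" 0 1]
      by (intro has_integral_add has_integral_mult_right L2) auto
    moreover have "((\<lambda>x. \<bar>sawtooth_error N x\<bar>) has_integral integral {0..1} (\<lambda>x. \<bar>sawtooth_error N x\<bar>)) {0..1}"
      by (intro integrable_integral integrable_continuous_real continuous_intros)
    moreover have "\<bar>v\<bar> \<le> \<delta> N / 2 + 1 / (2 * \<delta> N) * v\<^sup>2" for v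
    proof -
      have "0 \<le> (\<bar>v\<bar> - \<delta> N)\<^sup>2" by simp
      then show ?thesis using d by (simp add: field_simps power2_eq_square)
    qed
    ultimately have "integral {0..1} (\<lambda>x. \<bar>sawtooth_error N x\<bar>) \<le> \<delta> N / 2 + 1 / (2 * \<delta> N) * I N"
      by (meson has_integral_le)
    also have "\<dots> \<le> \<delta> N / 2 + 1 / (2 * \<delta> N) * (\<delta> N)\<^sup>2"
      using d by (intro add_left_mono mult_left_mono) auto
    also have "\<dots> = \<delta> N" using d by (simp add: power2_eq_square)
    finally show ?thesis .
  qed
  show ?thesis
    by (rule tendsto_sandwich[OF _ _ tendsto_const lim])
       (auto intro!: always_eventually bnd integral_nonneg integrable_continuous_real continuous_intros)
qed

text \<open>
  The Dirichlet kernel acts on a unit interval between integers like half a point mass at either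
  end. The error is estimated by integration by parts against \<open>sawtooth_error\<close>, and it is bounded
  in terms of the derivative on that interval only, so that it can later be summed over all \<open>k\<close>.
\<close>

lemma trapezoid_dirichlet:
  fixes G G' :: "real \<Rightarrow> complex" and k :: int
  assumes der: "\<And>x. (G has_vector_derivative G' x) (at x)"
    and cont: "continuous_on UNIV G'"
    and bnd: "\<And>x. x \<in> {real_of_int k..real_of_int k+1} \<Longrightarrow> norm (G' x) \<le> B"
  shows "norm (integral {real_of_int k..real_of_int k+1} (\<lambda>x. dirichlet_kernel N x *\<^sub>R G x) - (G (real_of_int k) + G (real_of_int k + 1)) / 2)
           \<le> B * integral {0..1} (\<lambda>x. \<bar>sawtooth_error N x\<bar>)"
proof -
  have contG: "continuous_on A G" for A
    using der by (meson continuous_at_imp_continuous_on has_vector_derivative_continuous)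
  have contG': "continuous_on A G'" for A
    using cont continuous_on_subset by blast
  have sG: "continuous_on {0..1} (\<lambda>x. G (real_of_int k + x))" "continuous_on {0..1} (\<lambda>x. G' (real_of_int k + x))"
    by (intro continuous_on_compose2[OF contG[of UNIV]] continuous_on_compose2[OF contG'[of UNIV]] continuous_intros; simp)+
  have per: "dirichlet_kernel N (real_of_int k + x) = dirichlet_kernel N x" for x
  proof -
    have "cos (2 * pi * real n * (real_of_int k + x)) = cos (2 * pi * real n * x)" for n
    proof -
      have "2 * pi * real n * (real_of_int k + x) = 2 * pi * real n * x + of_int (int n * k) * (2 * pi)"
        by (simp add: algebra_simps)
      then show ?thesis using cos.plus_of_int[of "2 * pi * real n * x" "int n * k"] by simp
    qed
    then show ?thesis by (simp add: dirichlet_kernel_def)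
  qed
  have dG: "((\<lambda>x. G (real_of_int k + x)) has_vector_derivative G' (real_of_int k + x)) (at x within S)" for x S
  proof -
    have "((\<lambda>x. real_of_int k + x) has_vector_derivative 1) (at x)"
      by (auto intro!: derivative_eq_intros)
    from vector_diff_chain_at[OF this der] show ?thesis
      by (simp add: o_def has_vector_derivative_at_within)
  qed
  have "((\<lambda>x. sawtooth_error N x *\<^sub>R G' (real_of_int k + x) + dirichlet_kernel N x *\<^sub>R G (real_of_int k + x)) has_integral
      (sawtooth_error N 1 *\<^sub>R G (real_of_int k + 1) - sawtooth_error N 0 *\<^sub>R G (real_of_int k + 0))) {0..1}"
    by (intro fundamental_theorem_of_calculus has_vector_derivative_scaleR dG sawtooth_error_deriv) simp
  then have 1: "((\<lambda>x. sawtooth_error N x *\<^sub>R G' (real_of_int k + x) + dirichlet_kernel N x *\<^sub>R G (real_of_int k + x)) has_integral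
      (G (real_of_int k) + G (real_of_int k + 1)) / 2) {0..1}"
    by (simp add: sawtooth_error_ends scaleR_conv_of_real field_simps)
  have 2: "((\<lambda>x. sawtooth_error N x *\<^sub>R G' (real_of_int k + x)) has_integral
       integral {0..1} (\<lambda>x. sawtooth_error N x *\<^sub>R G' (real_of_int k + x))) {0..1}"
    by (intro integrable_integral integrable_continuous_real continuous_intros sG)
  have "integral {0..1} (\<lambda>x. dirichlet_kernel N x *\<^sub>R G (real_of_int k + x)) =
      (G (real_of_int k) + G (real_of_int k + 1)) / 2 - integral {0..1} (\<lambda>x. sawtooth_error N x *\<^sub>R G' (real_of_int k + x))"
    using has_integral_diff[OF 1 2] by (simp add: integral_unique)
  moreover have "integral {0..1} (\<lambda>x. dirichlet_kernel N x *\<^sub>R G (real_of_int k + x)) =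
      integral {real_of_int k..real_of_int k+1} (\<lambda>x. dirichlet_kernel N x *\<^sub>R G x)"
    using integral_shift_Icc_real[of 0 1 "\<lambda>x. dirichlet_kernel N x *\<^sub>R G x" "real_of_int k"]
    by (simp add: o_def per add.commute[of "1::real"])
  moreover have "norm (integral {0..1} (\<lambda>x. sawtooth_error N x *\<^sub>R G' (real_of_int k + x)))
      \<le> integral {0..1} (\<lambda>x. B * \<bar>sawtooth_error N x\<bar>)"
    by (intro integral_norm_bound_integral integrable_continuous_real continuous_intros sG)
       (auto simp: mult.commute[of B] intro!: mult_left_mono bnd)
  ultimately show ?thesis by simp
qed

section \<open>Quadratic decay\<close>

definition quad_decay :: "(real \<Rightarrow> complex) \<Rightarrow> bool" where
  "quad_decay f \<longleftrightarrow> (\<exists>C. \<forall>x. norm (f x) * (1 + x\<^sup>2) \<le> C)"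

lemma one_plus_square_pos: "1 + x\<^sup>2 > (0::real)"
  by (simp add: add_pos_nonneg)

lemma quad_decayE:
  assumes "quad_decay f"
  obtains C where "C \<ge> 0" "\<And>x. norm (f x) \<le> C / (1 + x\<^sup>2)"
proof -
  obtain C where C: "\<And>x. norm (f x) * (1 + x\<^sup>2) \<le> C"
    using assms by (auto simp: quad_decay_def)
  have "norm (f 0) \<le> C" using C[of 0] by simp
  then have "C \<ge> 0" using norm_ge_zero order_trans by blast
  moreover have "norm (f x) \<le> C / (1 + x\<^sup>2)" for x
    using C[of x] one_plus_square_pos[of x] by (simp add: pos_le_divide_eq)
  ultimately show thesis using that by blast
qed

lemma quad_decayI:
  assumes "\<And>x. norm (f x) \<le> C / (1 + x\<^sup>2)"
  shows "quad_decay f"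
  unfolding quad_decay_def
  using assms one_plus_square_pos by (intro exI[of _ C]) (simp add: pos_le_divide_eq)

lemma quad_decay_add:
  assumes "quad_decay f" "quad_decay g"
  shows "quad_decay (\<lambda>x. f x + g x)"
proof -
  obtain C D where "\<And>x. norm (f x) \<le> C / (1 + x\<^sup>2)" "\<And>x. norm (g x) \<le> D / (1 + x\<^sup>2)"
    using assms by (metis quad_decayE)
  then have "norm (f x + g x) \<le> (C + D) / (1 + x\<^sup>2)" for x
    unfolding add_divide_distrib by (meson add_mono norm_triangle_ineq order_trans)
  then show ?thesis by (rule quad_decayI)
qed

lemma quad_decay_bounded_mult:
  assumes "quad_decay f" "\<And>x. norm (h x) \<le> B"
  shows "quad_decay (\<lambda>x. h x * f x)"
proof -
  obtain C where C: "\<And>x. norm (f x) \<le> C / (1 + x\<^sup>2)"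
    using assms by (metis quad_decayE)
  have "norm (h x * f x) \<le> (B * C) / (1 + x\<^sup>2)" for x
  proof -
    have "norm (h x * f x) \<le> B * (C / (1 + x\<^sup>2))"
      unfolding norm_mult using norm_ge_zero assms(2) C order_trans[OF norm_ge_zero assms(2)]
      by (intro mult_mono) auto
    then show ?thesis by simp
  qed
  then show ?thesis by (rule quad_decayI)
qed

text \<open>Quadratic decay survives an affine change of variable because the two weights are comparable.\<close>

lemma one_plus_square_affine_le:
  fixes s \<theta> x :: real
  assumes "s \<noteq> 0"
  shows "1 + x\<^sup>2 \<le> (1 + 2 * s\<^sup>2 + 2 * \<theta>\<^sup>2) * (1 + ((x + \<theta>) / s)\<^sup>2)"
proof -
  define u where "u = (x + \<theta>) / s"
  have x: "x = s * u - \<theta>" using assms by (simp add: u_def)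
  have "(s * u - \<theta>)\<^sup>2 \<le> 2 * (s * u)\<^sup>2 + 2 * \<theta>\<^sup>2"
    using zero_le_power2[of "s * u + \<theta>"] by (simp add: power2_eq_square algebra_simps)
  moreover have "0 \<le> 2 * s\<^sup>2 + (1 + 2 * \<theta>\<^sup>2) * u\<^sup>2" by simp
  moreover have "(1 + 2 * s\<^sup>2 + 2 * \<theta>\<^sup>2) * (1 + u\<^sup>2) =
      1 + (2 * (s * u)\<^sup>2 + 2 * \<theta>\<^sup>2) + (2 * s\<^sup>2 + (1 + 2 * \<theta>\<^sup>2) * u\<^sup>2)"
    by (simp add: algebra_simps power_mult_distrib)
  ultimately show ?thesis
    unfolding u_def[symmetric] unfolding x by linarith
qed

lemma quad_decay_affine:
  assumes "quad_decay f" "s \<noteq> 0"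
  shows "quad_decay (\<lambda>x. f ((x + \<theta>) / s))"
proof -
  obtain C where C: "C \<ge> 0" "\<And>x. norm (f x) \<le> C / (1 + x\<^sup>2)"
    using assms by (metis quad_decayE)
  define K where "K = 1 + 2 * s\<^sup>2 + 2 * \<theta>\<^sup>2"
  have "norm (f ((x + \<theta>) / s)) \<le> C * K / (1 + x\<^sup>2)" for x
  proof -
    have "C * (1 + x\<^sup>2) \<le> C * (K * (1 + ((x + \<theta>) / s)\<^sup>2))"
      unfolding K_def using C(1) by (intro mult_left_mono one_plus_square_affine_le assms)
    then have "C / (1 + ((x + \<theta>) / s)\<^sup>2) \<le> C * K / (1 + x\<^sup>2)"
      using one_plus_square_pos by (simp add: divide_le_eq le_divide_eq mult_ac)
    with C(2) show ?thesis by (rule order_trans)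
  qed
  then show ?thesis by (rule quad_decayI)
qed

lemma quad_decay_integrable:
  assumes "quad_decay f" "continuous_on UNIV f"
  shows "integrable lborel f"
proof -
  obtain C where C: "C \<ge> 0" "\<And>x. norm (f x) \<le> C / (1 + x\<^sup>2)"
    using assms by (metis quad_decayE)
  have "integrable lborel (\<lambda>x::real. C * inverse (1 + x\<^sup>2))"
    using integrable_inverse_1_plus_square by (simp add: set_integrable_def)
  then show ?thesis
  proof (rule Bochner_Integration.integrable_bound)
    show "f \<in> borel_measurable lborel"
      using assms(2) by (simp add: borel_measurable_continuous_onI)
    show "AE x in lborel. norm (f x) \<le> norm (C * inverse (1 + x\<^sup>2))"
      using C by (auto simp: divide_inverse)
  qed
qed

lemma summable_inverse_one_plus_square_int:
  "(\<lambda>k::int. 1 / (1 + (real_of_int k)\<^sup>2)) summable_on UNIV"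
proof -
  let ?f = "\<lambda>k::int. 1 / (1 + (real_of_int k)\<^sup>2)"
  have "norm (1 / (1 + (real n)\<^sup>2)) \<le> inverse ((real n)\<^sup>2)" if "n \<ge> 1" for n
    using that by (simp add: inverse_eq_divide frac_le)
  then have "summable (\<lambda>n. 1 / (1 + (real n)\<^sup>2))"
    by (intro summable_comparison_test_ev[OF _ inverse_power_summable[of 2]] eventually_sequentiallyI[of 1]) auto
  then have nat: "(\<lambda>n. 1 / (1 + (real n)\<^sup>2)) summable_on UNIV"
    by (subst summable_on_UNIV_nonneg_real_iff) auto
  have "?f summable_on range int"
    by (subst summable_on_reindex) (use nat in \<open>auto simp: o_def\<close>)
  moreover have "?f summable_on range (\<lambda>n. - int n)"
    by (subst summable_on_reindex) (use nat in \<open>auto simp: o_def inj_on_def\<close>)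
  ultimately have "?f summable_on (range int \<union> range (\<lambda>n. - int n))"
    by (rule summable_on_union)
  moreover have "range int \<union> range (\<lambda>n. - int n) = UNIV"
    by (metis (no_types, lifting) UNIV_eq_I UnCI int_cases2 rangeI)
  ultimately show ?thesis by simp
qed

lemma quad_decay_summable:
  assumes "quad_decay f"
  shows "(\<lambda>k::int. norm (f (of_int k))) summable_on UNIV"
proof -
  obtain C where C: "C \<ge> 0" "\<And>x. norm (f x) \<le> C / (1 + x\<^sup>2)"
    using assms by (metis quad_decayE)
  show ?thesis
    by (rule summable_on_comparison_test[OF summable_on_cmult_right[OF summable_inverse_one_plus_square_int, of C]])
       (use C in auto)
qed

lemma filterlim_int_interval:
  assumes "filterlim a at_bot sequentially" "filterlim b at_top sequentially"
  shows "filterlim (\<lambda>n. {a n..b n :: int}) (finite_subsets_at_top UNIV) sequentially"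
  unfolding filterlim_finite_subsets_at_top
proof (intro allI impI)
  fix X :: "int set" assume "finite X \<and> X \<subseteq> UNIV"
  then obtain l u where lu: "X \<subseteq> {l..u}"
    by (meson Max_ge Min_le atLeastAtMost_iff subsetI)
  have "eventually (\<lambda>n. a n \<le> l) sequentially" "eventually (\<lambda>n. u \<le> b n) sequentially"
    using assms by (simp_all add: filterlim_at_top filterlim_at_bot)
  then show "eventually (\<lambda>n. finite {a n..b n} \<and> X \<subseteq> {a n..b n} \<and> {a n..b n} \<subseteq> UNIV) sequentially"
    by eventually_elim (use lu in auto)
qed

lemma has_sum_int_tendsto:
  fixes f :: "int \<Rightarrow> 'a :: {comm_monoid_add, topological_space}"
  assumes "(f has_sum S) UNIV"
  shows "(\<lambda>N. \<Sum>k\<in>{- int N..int N}. f k) \<longlonglongrightarrow> S" "(\<lambda>N. \<Sum>k\<in>{- int N..int N - 1}. f k) \<longlonglongrightarrow> S"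
proof -
  have 1: "filterlim (\<lambda>n. - int n) at_bot sequentially"
    unfolding filterlim_at_bot
  proof
    fix Z :: int
    show "\<forall>\<^sub>F x in sequentially. - int x \<le> Z"
      by (rule eventually_sequentiallyI[of "nat (- Z)"]) auto
  qed
  have 2: "filterlim (\<lambda>n. int n - 1) at_top sequentially"
    unfolding filterlim_at_top
  proof
    fix Z :: int
    show "\<forall>\<^sub>F x in sequentially. Z \<le> int x - 1"
      by (rule eventually_sequentiallyI[of "nat (Z + 1)"]) auto
  qed
  have S: "(sum f \<longlongrightarrow> S) (finite_subsets_at_top UNIV)"
    using assms by (simp add: has_sum_def)
  show "(\<lambda>N. \<Sum>k\<in>{- int N..int N}. f k) \<longlonglongrightarrow> S"
    by (rule filterlim_compose[OF S filterlim_int_interval[OF 1 filterlim_int_sequentially]])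
  show "(\<lambda>N. \<Sum>k\<in>{- int N..int N - 1}. f k) \<longlonglongrightarrow> S"
    by (rule filterlim_compose[OF S filterlim_int_interval[OF 1 2]])
qed

text \<open>
  Integrals over the line thus reduce to sums over unit intervals, and to the fundamental theorem
  of calculus on bounded intervals.
\<close>

lemma tendsto_integral_symmetric:
  fixes f :: "real \<Rightarrow> complex"
  assumes f: "integrable lborel f"
  shows "(\<lambda>M. integral {- real M..real M} f) \<longlonglongrightarrow> (LBINT x. f x)"
proof -
  have [measurable]: "f \<in> borel_measurable borel" using f by auto
  have "(\<lambda>M. LBINT x. indicator {- real M..real M} x *\<^sub>R f x) \<longlonglongrightarrow> (LBINT x. f x)"
  proof (rule integral_dominated_convergence)
    show "integrable lborel (\<lambda>x. norm (f x))" using f by simp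
    show "AE x in lborel. (\<lambda>M. indicator {- real M..real M} x *\<^sub>R f x) \<longlonglongrightarrow> f x"
    proof (rule AE_I2)
      fix x :: real
      obtain N where "\<bar>x\<bar> \<le> real N" using real_arch_simple by blast
      then have "eventually (\<lambda>M. indicator {- real M..real M} x *\<^sub>R f x = f x) sequentially"
        by (intro eventually_sequentiallyI[of N]) (auto simp: indicator_def)
      then show "(\<lambda>M. indicator {- real M..real M} x *\<^sub>R f x) \<longlonglongrightarrow> f x"
        by (rule tendsto_eventually)
    qed
  qed (auto simp: indicator_def)
  moreover have "(LBINT x. indicator {- real M..real M} x *\<^sub>R f x) = integral {- real M..real M} f" for M
  proof -
    have "set_integrable lborel {- real M..real M} f"
      unfolding set_integrable_def using f by (intro integrable_mult_indicator) auto
    from set_borel_integral_eq_integral(2)[OF this] show ?thesis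
      by (simp add: set_lebesgue_integral_def)
  qed
  ultimately show ?thesis by simp
qed

lemma integral_deriv_eq_0:
  fixes F f :: "real \<Rightarrow> complex"
  assumes der: "\<And>x. (F has_vector_derivative f x) (at x)"
    and "continuous_on UNIV f" "quad_decay F" "quad_decay f"
  shows "(LBINT x. f x) = 0"
proof -
  obtain C where C: "C \<ge> 0" "\<And>x. norm (F x) \<le> C / (1 + x\<^sup>2)"
    using assms by (metis quad_decayE)
  have ftc: "integral {- real M..real M} f = F (real M) - F (- real M)" for M
    by (rule integral_unique, rule fundamental_theorem_of_calculus)
       (auto intro!: has_vector_derivative_at_within der)
  have "(\<lambda>M. 2 * C / (1 + (real M)\<^sup>2)) \<longlonglongrightarrow> 0"
    by (intro real_tendsto_divide_at_top[OF tendsto_const] filterlim_tendsto_add_at_top[OF tendsto_const]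
          filterlim_pow_at_top filterlim_real_sequentially) auto
  moreover have "norm (F (real M) - F (- real M)) \<le> 2 * C / (1 + (real M)\<^sup>2)" for M
    using norm_triangle_ineq4[of "F (real M)" "F (- real M)"] C(2)[of "real M"] C(2)[of "- real M"] by simp
  ultimately have "(\<lambda>M. F (real M) - F (- real M)) \<longlonglongrightarrow> 0"
    by (intro Lim_null_comparison[of "\<lambda>M. F (real M) - F (- real M)" "\<lambda>M. 2 * C / (1 + (real M)\<^sup>2)"]
          always_eventually) auto
  moreover have "(\<lambda>M. F (real M) - F (- real M)) \<longlonglongrightarrow> (LBINT x. f x)"
    using tendsto_integral_symmetric[OF quad_decay_integrable[of f]] assms by (simp add: ftc)
  ultimately show ?thesis using LIMSEQ_unique by metis
qed

section \<open>Fourier transforms and Poisson summation\<close>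

definition fourier :: "(real \<Rightarrow> complex) \<Rightarrow> real \<Rightarrow> complex" where
  "fourier G \<xi> = (LBINT x. cis (- 2 * pi * \<xi> * x) * G x)"

text \<open>
  A class for which Poisson summation has a short proof: one derivative controls the error of the
  trapezoidal rule, and two make the Fourier transform summable over lattices.
\<close>

definition decaying_C2 :: "(real \<Rightarrow> complex) \<Rightarrow> bool" where
  "decaying_C2 G \<longleftrightarrow> (\<exists>G' G''. (\<forall>x. (G has_vector_derivative G' x) (at x)) \<and>
     (\<forall>x. (G' has_vector_derivative G'' x) (at x)) \<and> continuous_on UNIV G'' \<and>
     quad_decay G \<and> quad_decay G' \<and> quad_decay G'')"

lemma cis_has_vector_derivative:
  assumes "(h has_real_derivative h') (at x)"
  shows "((\<lambda>x. cis (h x)) has_vector_derivative (\<i> * h' * cis (h x))) (at x)"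
proof -
  have "((\<lambda>x. \<i> * of_real (h x)) has_vector_derivative \<i> * of_real h') (at x)"
    by (intro has_vector_derivative_mult_right has_vector_derivative_of_real)
       (use assms in \<open>simp add: has_real_derivative_iff_has_vector_derivative\<close>)
  from field_vector_diff_chain_at[OF this DERIV_exp] show ?thesis
    by (simp add: o_def cis_conv_exp)
qed

text \<open>The integrand of the difference of the two sides is a derivative, so its integral vanishes.\<close>

lemma fourier_deriv:
  assumes der: "\<And>x. (G has_vector_derivative G' x) (at x)"
    and "continuous_on UNIV G'" "quad_decay G" "quad_decay G'"
  shows "fourier G' \<xi> = 2 * pi * \<i> * \<xi> * fourier G \<xi>"
proof -
  have contG: "continuous_on UNIV G"
    using der by (meson continuous_at_imp_continuous_on has_vector_derivative_continuous)
  have cc: "continuous_on UNIV (\<lambda>x. cis (- 2 * pi * \<xi> * x))"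
    by (intro continuous_intros)
  have D: "((\<lambda>x. cis (- 2 * pi * \<xi> * x) * G x) has_vector_derivative
      (cis (- 2 * pi * \<xi> * x) * G' x + (\<i> * (- 2 * pi * \<xi>) * cis (- 2 * pi * \<xi> * x)) * G x)) (at x)" for x
    by (intro has_vector_derivative_mult der, rule has_vector_derivative_eq_rhs[OF cis_has_vector_derivative])
       (auto intro!: derivative_eq_intros)
  have d1: "quad_decay (\<lambda>x. cis (- 2 * pi * \<xi> * x) * G' x)" "quad_decay (\<lambda>x. cis (- 2 * pi * \<xi> * x) * G x)"
    using assms by (auto intro!: quad_decay_bounded_mult[where B = 1])
  have d2: "quad_decay (\<lambda>x. (\<i> * (- 2 * pi * \<xi>) * cis (- 2 * pi * \<xi> * x)) * G x)"
    by (rule quad_decay_bounded_mult[where B = "2 * pi * \<bar>\<xi>\<bar>"]) (use assms in \<open>auto simp: norm_mult\<close>)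
  have "(LBINT x. cis (- 2 * pi * \<xi> * x) * G' x + (\<i> * (- 2 * pi * \<xi>) * cis (- 2 * pi * \<xi> * x)) * G x) = 0"
    using d1 d2 assms contG by (intro integral_deriv_eq_0[OF D] continuous_intros quad_decay_add cc) auto
  also have "(LBINT x. cis (- 2 * pi * \<xi> * x) * G' x + (\<i> * (- 2 * pi * \<xi>) * cis (- 2 * pi * \<xi> * x)) * G x) =
     fourier G' \<xi> + (LBINT x. (\<i> * (- 2 * pi * \<xi>) * cis (- 2 * pi * \<xi> * x)) * G x)"
    unfolding fourier_def using assms contG
    by (intro Bochner_Integration.integral_add quad_decay_integrable d1 d2 continuous_intros cc)
  also have "(LBINT x. (\<i> * (- 2 * pi * \<xi>) * cis (- 2 * pi * \<xi> * x)) * G x) = (\<i> * (- 2 * pi * \<xi>)) * fourier G \<xi>"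
    unfolding fourier_def by (subst integral_mult_right_zero[symmetric]) (simp add: mult_ac)
  finally show ?thesis by (simp add: algebra_simps)
qed

lemma norm_fourier_le: "norm (fourier G \<xi>) \<le> (LBINT x. norm (G x))"
  unfolding fourier_def by (rule order_trans[OF integral_norm_bound]) (simp add: norm_mult)

text \<open>The transform of the second derivative is bounded, and it is \<open>- (2 \<pi> \<xi>)\<^sup>2\<close> times that of \<open>G\<close>.\<close>

lemma quad_decay_fourier:
  assumes "decaying_C2 G"
  shows "quad_decay (fourier G)"
proof -
  obtain G' G'' where G: "\<And>x. (G has_vector_derivative G' x) (at x)"
     "\<And>x. (G' has_vector_derivative G'' x) (at x)" "continuous_on UNIV G''"
     "quad_decay G" "quad_decay G'" "quad_decay G''"
    using assms by (auto simp: decaying_C2_def)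
  have cG': "continuous_on UNIV G'"
    using G by (meson continuous_at_imp_continuous_on has_vector_derivative_continuous)
  have "fourier G'' \<xi> = 2 * pi * \<i> * \<xi> * (2 * pi * \<i> * \<xi> * fourier G \<xi>)" for \<xi>
    using fourier_deriv[OF G(2,3,5,6)] fourier_deriv[OF G(1) cG' G(4,5)] by simp
  then have "norm (fourier G'' \<xi>) = (2 * pi)\<^sup>2 * \<xi>\<^sup>2 * norm (fourier G \<xi>)" for \<xi>
    by (simp add: norm_mult power2_eq_square)
  then have le: "(2 * pi)\<^sup>2 * \<xi>\<^sup>2 * norm (fourier G \<xi>) \<le> (LBINT x. norm (G'' x))" for \<xi>
    by (metis norm_fourier_le)
  have "(2 * pi)\<^sup>2 \<ge> (1::real)\<^sup>2"
    using pi_ge_two by (intro power_mono) auto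
  then have "\<xi>\<^sup>2 * norm (fourier G \<xi>) \<le> (2 * pi)\<^sup>2 * \<xi>\<^sup>2 * norm (fourier G \<xi>)" for \<xi>
    using mult_right_mono[of 1 "(2 * pi)\<^sup>2" "\<xi>\<^sup>2 * norm (fourier G \<xi>)"] by (simp add: mult_ac)
  then have "norm (fourier G \<xi>) * (1 + \<xi>\<^sup>2) \<le> (LBINT x. norm (G x)) + (LBINT x. norm (G'' x))" for \<xi>
    using norm_fourier_le[of G \<xi>] le[of \<xi>] order_trans
    by (simp add: ring_distribs mult.commute) (smt (verit))
  then show ?thesis unfolding quad_decay_def by blast
qed

lemma dirichlet_kernel_eq_sum_cis:
  "of_real (dirichlet_kernel N x) = (\<Sum>m\<in>{- int N..int N}. cis (- 2 * pi * of_int m * x))"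
proof (induction N)
  case 0
  then show ?case by (simp add: dirichlet_kernel_def)
next
  case (Suc N)
  have "{- int (Suc N)..int (Suc N)} = insert (int (Suc N)) (insert (- int (Suc N)) {- int N..int N})"
    by auto
  then have "(\<Sum>m\<in>{- int (Suc N)..int (Suc N)}. cis (- 2 * pi * of_int m * x)) =
     cis (- 2 * pi * (1 + real N) * x) + (cis (2 * pi * (1 + real N) * x) + of_real (dirichlet_kernel N x))"
    by (simp add: Suc.IH) (simp add: algebra_simps)
  also have "\<dots> = of_real (dirichlet_kernel (Suc N) x)"
    by (simp add: dirichlet_kernel_def complex_eq_iff)
  finally show ?case by simp
qed

lemma fourier_partial_sums:
  assumes "quad_decay G" "continuous_on UNIV G"
  shows "(\<Sum>m\<in>{- int N..int N}. fourier G (of_int m)) = (LBINT x. dirichlet_kernel N x *\<^sub>R G x)"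
    and "integrable lborel (\<lambda>x. dirichlet_kernel N x *\<^sub>R G x)"
proof -
  have int: "integrable lborel (\<lambda>x. cis (- 2 * pi * of_int m * x) * G x)" for m :: int
    using assms by (intro quad_decay_integrable quad_decay_bounded_mult[where B = 1] continuous_intros) auto
  have eq: "dirichlet_kernel N x *\<^sub>R G x = (\<Sum>m\<in>{- int N..int N}. cis (- 2 * pi * of_int m * x) * G x)" for x
    unfolding scaleR_conv_of_real dirichlet_kernel_eq_sum_cis sum_distrib_right ..
  show "(\<Sum>m\<in>{- int N..int N}. fourier G (of_int m)) = (LBINT x. dirichlet_kernel N x *\<^sub>R G x)"
    unfolding fourier_def eq by (rule Bochner_Integration.integral_sum[symmetric]) (rule int)
  show "integrable lborel (\<lambda>x. dirichlet_kernel N x *\<^sub>R G x)"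
    unfolding eq by (rule Bochner_Integration.integrable_sum) (rule int)
qed

lemma integral_split_unit_intervals:
  fixes f :: "real \<Rightarrow> complex"
  assumes "continuous_on UNIV f"
  shows "integral {- real M..real M} f =
    (\<Sum>k\<in>{- int M..int M - 1}. integral {real_of_int k..real_of_int k + 1} f)"
proof (induction M)
  case (Suc M)
  have int: "f integrable_on {a..b}" for a b
    using assms by (meson continuous_on_subset integrable_continuous_real subset_UNIV)
  have "{- int (Suc M)..int (Suc M) - 1} = insert (int M) (insert (- int (Suc M)) {- int M..int M - 1})"
    by auto
  then have "(\<Sum>k\<in>{- int (Suc M)..int (Suc M) - 1}. integral {real_of_int k..real_of_int k + 1} f) =
    integral {real M..real M + 1} f + (integral {- 1 - real M..- real M} f + integral {- real M..real M} f)"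
    by (simp add: Suc.IH)
  also have "\<dots> = integral {- 1 - real M..real M + 1} f"
    using Henstock_Kurzweil_Integration.integral_combine[of "- 1 - real M" "- real M" "real M" f]
      Henstock_Kurzweil_Integration.integral_combine[of "- 1 - real M" "real M" "real M + 1" f] int
    by (simp add: add.commute)
  finally show ?case by (simp add: algebra_simps)
qed simp

text \<open>
  Both sides are limits of symmetric partial sums. The partial sum \<open>A N\<close> of the left side is the
  integral of \<open>G\<close> against the Dirichlet kernel. Cut at the integers, it agrees with the trapezoidal
  sum, which has the same total as \<open>\<Sum>k. G k\<close>, up to the mean of the sawtooth error times a series in
  \<open>k\<close> that converges by the decay of \<open>G'\<close>.
\<close>

theorem poisson_summation:
  assumes "decaying_C2 G"
  shows "(\<Sum>\<^sub>\<infinity>m::int. fourier G (of_int m)) = (\<Sum>\<^sub>\<infinity>k::int. G (of_int k))"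
proof -
  obtain G' G'' where G: "\<And>x. (G has_vector_derivative G' x) (at x)"
     "\<And>x. (G' has_vector_derivative G'' x) (at x)"
     "quad_decay G" "quad_decay G'"
    using assms by (auto simp: decaying_C2_def)
  have cont: "continuous_on UNIV G" "continuous_on UNIV G'"
    using G by (meson continuous_at_imp_continuous_on has_vector_derivative_continuous)+
  obtain C where C: "C \<ge> 0" "\<And>x. norm (G' x) \<le> C / (1 + x\<^sup>2)"
    using G by (metis quad_decayE)
  define S where "S = (\<Sum>\<^sub>\<infinity>k::int. G (of_int k))"
  define K where "K = (\<Sum>\<^sub>\<infinity>k::int. 3 * C * (1 / (1 + (real_of_int k)\<^sup>2)))"
  define L where "L N = integral {0..1} (\<lambda>x. \<bar>sawtooth_error N x\<bar>)" for N
  define A where "A N = (LBINT x. dirichlet_kernel N x *\<^sub>R G x)" for N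
  have K: "((\<lambda>k::int. 3 * C * (1 / (1 + (real_of_int k)\<^sup>2))) has_sum K) UNIV"
    unfolding K_def by (rule has_sum_infsum[OF summable_on_cmult_right[OF summable_inverse_one_plus_square_int]])
  have hsS: "((\<lambda>k::int. G (of_int k)) has_sum S) UNIV"
    unfolding S_def by (rule has_sum_infsum[OF abs_summable_summable[OF quad_decay_summable[OF G(3)]]])
  have hsS1: "((\<lambda>k::int. G (real_of_int k + 1)) has_sum S) UNIV"
    using hsS has_sum_reindex_bij_betw[of "\<lambda>k::int. k + 1" UNIV UNIV "\<lambda>k. G (real_of_int k)" S]
    by (simp add: bij_plus_right)
  have "((\<lambda>k::int. (G (of_int k) + G (real_of_int k + 1)) * (1/2)) has_sum (S + S) * (1/2)) UNIV"
    by (intro has_sum_cmult_left has_sum_add hsS hsS1)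
  then have trap: "((\<lambda>k::int. (G (of_int k) + G (real_of_int k + 1)) / 2) has_sum S) UNIV"
    by simp
  have arith: "1 + k \<le> 3 * (1 + y)" if "d \<le> 1" "k \<le> 2 * y + 2 * d" "0 \<le> y" for k y d :: real
    using that unfolding ring_distribs by linarith
  \<comment> \<open>Moving from a point of \<open>[k, k + 1]\<close> to \<open>k\<close> costs at most a factor \<open>3\<close> in the weight.\<close>
  have bound: "norm (G' x) \<le> 3 * C * (1 / (1 + (real_of_int k)\<^sup>2))"
    if "x \<in> {real_of_int k..real_of_int k + 1}" for x k
  proof -
    have "(x - real_of_int k)\<^sup>2 \<le> 1" using that by (intro power_le_one) auto
    moreover have "(real_of_int k)\<^sup>2 \<le> 2 * x\<^sup>2 + 2 * (x - real_of_int k)\<^sup>2"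
      using zero_le_power2[of "2 * x - real_of_int k"] by (simp add: power2_eq_square algebra_simps)
    ultimately have "1 + (real_of_int k)\<^sup>2 \<le> 3 * (1 + x\<^sup>2)"
      using zero_le_power2[of x] by (rule arith)
    then have "C * (1 + (real_of_int k)\<^sup>2) \<le> C * (3 * (1 + x\<^sup>2))" using C(1) by (rule mult_left_mono)
    then have "C / (1 + x\<^sup>2) \<le> 3 * C * (1 / (1 + (real_of_int k)\<^sup>2))"
      using one_plus_square_pos by (simp add: divide_le_eq le_divide_eq mult_ac)
    with C(2) show ?thesis by (rule order_trans)
  qed
  have approx: "norm (A N - S) \<le> K * L N" for N
  proof -
    define f where "f x = dirichlet_kernel N x *\<^sub>R G x" for x
    have contf: "continuous_on UNIV f"
      unfolding f_def by (intro continuous_intros cont)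
    have "(\<lambda>M. integral {- real M..real M} f - (\<Sum>k\<in>{- int M..int M - 1}. (G (of_int k) + G (real_of_int k + 1)) / 2))
       \<longlonglongrightarrow> A N - S"
      using tendsto_integral_symmetric[OF fourier_partial_sums(2)[OF G(3) cont(1), of N]]
      by (intro tendsto_diff has_sum_int_tendsto[OF trap]) (simp add: A_def f_def[abs_def])
    then have lim: "(\<lambda>M. norm (integral {- real M..real M} f - (\<Sum>k\<in>{- int M..int M - 1}. (G (of_int k) + G (real_of_int k + 1)) / 2)))
       \<longlonglongrightarrow> norm (A N - S)" by (rule tendsto_norm)
    have "norm (integral {- real M..real M} f - (\<Sum>k\<in>{- int M..int M - 1}. (G (of_int k) + G (real_of_int k + 1)) / 2))
       \<le> (\<Sum>k\<in>{- int M..int M - 1}. 3 * C * (1 / (1 + (real_of_int k)\<^sup>2))) * L N" for M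
      unfolding integral_split_unit_intervals[OF contf] sum_subtractf[symmetric] sum_distrib_right
      unfolding f_def L_def
      by (rule sum_norm_le, rule trapezoid_dirichlet[OF G(1) cont(2) bound])
    moreover have "(\<lambda>M. (\<Sum>k\<in>{- int M..int M - 1}. 3 * C * (1 / (1 + (real_of_int k)\<^sup>2))) * L N) \<longlonglongrightarrow> K * L N"
      by (intro tendsto_intros has_sum_int_tendsto[OF K])
    ultimately show ?thesis
      using lim by (meson LIMSEQ_le)
  qed
  have "(\<lambda>N. K * L N) \<longlonglongrightarrow> K * 0"
    unfolding L_def by (intro tendsto_intros sawtooth_error_L1_tendsto_0)
  then have "(\<lambda>N. A N - S) \<longlonglongrightarrow> 0"
    using approx by (intro Lim_null_comparison[of "\<lambda>N. A N - S" "\<lambda>N. K * L N"] always_eventually) auto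
  then have "A \<longlonglongrightarrow> S" by (simp add: LIM_zero_iff)
  moreover have "A \<longlonglongrightarrow> (\<Sum>\<^sub>\<infinity>m::int. fourier G (of_int m))"
    unfolding A_def fourier_partial_sums(1)[OF G(3) cont(1), symmetric]
    by (rule has_sum_int_tendsto(1)[OF has_sum_infsum[OF abs_summable_summable[OF
          quad_decay_summable[OF quad_decay_fourier[OF assms]]]]])
  ultimately show ?thesis unfolding S_def using LIMSEQ_unique by blast
qed

lemma decaying_C2_affine:
  assumes "decaying_C2 G" "s \<noteq> 0"
  shows "decaying_C2 (\<lambda>x. G ((x + \<theta>) / s))"
proof -
  obtain G' G'' where G: "\<And>x. (G has_vector_derivative G' x) (at x)"
     "\<And>x. (G' has_vector_derivative G'' x) (at x)" "continuous_on UNIV G''"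
     "quad_decay G" "quad_decay G'" "quad_decay G''"
    using assms by (auto simp: decaying_C2_def)
  have chain: "((\<lambda>x. F ((x + \<theta>) / s)) has_vector_derivative F' ((x + \<theta>) / s) / s) (at x)"
    if "\<And>x. (F has_vector_derivative F' x) (at x)" for F F' :: "real \<Rightarrow> complex" and x
  proof -
    have "((\<lambda>x. (x + \<theta>) / s) has_vector_derivative 1 / s) (at x)"
      using assms by (auto intro!: derivative_eq_intros simp flip: has_real_derivative_iff_has_vector_derivative)
    from vector_diff_chain_at[OF this that] show ?thesis
      by (simp add: o_def scaleR_conv_of_real)
  qed
  have chain2: "((\<lambda>x. G' ((x + \<theta>) / s) / s) has_vector_derivative G'' ((x + \<theta>) / s) / s / s) (at x)" for x
    by (intro has_vector_derivative_divide chain G)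
  have div: "quad_decay (\<lambda>x. f x / s)" if "quad_decay f" for f
    using quad_decay_bounded_mult[OF that, of "\<lambda>x. 1 / of_real s" "norm (1 / of_real s :: complex)"] by simp
  have "continuous_on UNIV (\<lambda>x. G'' ((x + \<theta>) / s) / s / s)"
    using assms by (intro continuous_intros continuous_on_compose2[OF G(3)]) auto
  then show ?thesis
    unfolding decaying_C2_def
    by (intro exI[of _ "\<lambda>x. G' ((x + \<theta>) / s) / s"] exI[of _ "\<lambda>x. G'' ((x + \<theta>) / s) / s / s"]
          conjI allI chain chain2 G div quad_decay_affine assms)
qed

lemma decaying_C2_quad_decay: "decaying_C2 G \<Longrightarrow> quad_decay G"
  by (auto simp: decaying_C2_def)

lemma fourier_affine:
  assumes "s > 0"
  shows "fourier (\<lambda>x. G ((x + \<theta>) / s)) \<xi> = s * cis (2 * pi * \<theta> * \<xi>) * fourier G (s * \<xi>)"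
proof -
  have "fourier (\<lambda>x. G ((x + \<theta>) / s)) \<xi> =
    s *\<^sub>R (LBINT y. cis (- 2 * pi * \<xi> * (- \<theta> + s * y)) * G ((- \<theta> + s * y + \<theta>) / s))"
    unfolding fourier_def
    using lborel_integral_real_affine[of s "\<lambda>x. cis (- 2 * pi * \<xi> * x) * G ((x + \<theta>) / s)" "- \<theta>"] assms
    by simp
  also have "(LBINT y. cis (- 2 * pi * \<xi> * (- \<theta> + s * y)) * G ((- \<theta> + s * y + \<theta>) / s)) =
     (LBINT y. cis (2 * pi * \<theta> * \<xi>) * (cis (- 2 * pi * (s * \<xi>) * y) * G y))"
  proof -
    have "cis (- 2 * pi * \<xi> * (- \<theta> + s * y)) = cis (2 * pi * \<theta> * \<xi>) * cis (- 2 * pi * (s * \<xi>) * y)" for y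
      by (simp add: cis_mult algebra_simps)
    moreover have "(- \<theta> + s * y + \<theta>) / s = y" for y
      using assms by simp
    ultimately show ?thesis by (simp only: mult.assoc)
  qed
  finally show ?thesis by (simp add: fourier_def scaleR_conv_of_real)
qed

text \<open>
  Twisting the frequency side by a character is the same as shifting the lattice: it is Poisson
  summation for \<open>G ((x + \<theta>) / s)\<close>.
\<close>

lemma poisson_summation_twisted:
  fixes s \<theta> :: real and G :: "real \<Rightarrow> complex"
  assumes "decaying_C2 G" "s > 0"
  shows "(\<Sum>\<^sub>\<infinity>m::int. cis (2 * pi * \<theta> * m) * fourier G (s * m)) = 1 / s * (\<Sum>\<^sub>\<infinity>k::int. G ((k + \<theta>) / s))"
proof -
  have "(\<Sum>\<^sub>\<infinity>m::int. s * (cis (2 * pi * \<theta> * m) * fourier G (s * m))) = (\<Sum>\<^sub>\<infinity>k::int. G ((k + \<theta>) / s))"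
    using poisson_summation[OF decaying_C2_affine[OF assms(1)], of s \<theta>] assms
    by (simp add: fourier_affine mult.assoc)
  then show ?thesis
    using assms(2) by (simp add: infsum_cmult_right' field_simps)
qed

section \<open>Schwartz functions and lattice sums as tempered distributions\<close>

lemma schwartz_has_vector_derivative:
  assumes "\<phi> \<in> schwartz"
  shows "((vderiv ^^ n) \<phi> has_vector_derivative (vderiv ^^ Suc n) \<phi> x) (at x)"
proof -
  have "(vderiv ^^ n) \<phi> differentiable (at x)"
    using assms by (simp add: schwartz_def)
  then have "((vderiv ^^ n) \<phi> has_vector_derivative vector_derivative ((vderiv ^^ n) \<phi>) (at x)) (at x)"
    by (simp add: vector_derivative_works)
  then show ?thesis by (simp add: vderiv_def)
qed

lemma schwartz_continuous:
  assumes "\<phi> \<in> schwartz"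
  shows "continuous_on A ((vderiv ^^ n) \<phi>)"
  using schwartz_has_vector_derivative[OF assms]
  by (meson continuous_at_imp_continuous_on has_vector_derivative_continuous)

lemma schwartz_quad_decay:
  assumes "\<phi> \<in> schwartz"
  shows "quad_decay (\<lambda>x. of_real x ^ j * (vderiv ^^ n) \<phi> x)"
proof -
  have b: "bounded (range (\<lambda>x. x ^ j *\<^sub>R (vderiv ^^ n) \<phi> x))" for j
    using assms by (simp add: schwartz_def)
  obtain C D where C: "\<And>x. norm (x ^ j *\<^sub>R (vderiv ^^ n) \<phi> x) \<le> C"
    and D: "\<And>x. norm (x ^ (j + 2) *\<^sub>R (vderiv ^^ n) \<phi> x) \<le> D"
    using b[of j] b[of "j + 2"] unfolding bounded_iff by auto
  have "norm (of_real x ^ j * (vderiv ^^ n) \<phi> x) * (1 + x\<^sup>2) \<le> C + D" for x :: real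
  proof -
    have "norm (x ^ (j + 2) *\<^sub>R (vderiv ^^ n) \<phi> x) = norm (x ^ j *\<^sub>R (vderiv ^^ n) \<phi> x) * x\<^sup>2"
      unfolding power_add by (simp add: abs_mult)
    moreover have "norm (of_real x ^ j * (vderiv ^^ n) \<phi> x) = norm (x ^ j *\<^sub>R (vderiv ^^ n) \<phi> x)"
      by (simp add: norm_mult norm_power power_abs)
    ultimately show ?thesis
      using C[of x] D[of x] by (simp only: distrib_left mult_1_right)
  qed
  then show ?thesis unfolding quad_decay_def by blast
qed

lemma schwartz_quad_decay_self: "\<phi> \<in> schwartz \<Longrightarrow> quad_decay \<phi>"
  using schwartz_quad_decay[of \<phi> 0 0] by simp

text \<open>
  Each derivative of the product with a chirp brings down a factor of degree at most one in \<open>x\<close>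
  (the function \<open>h\<close> in the proof), which the decay of Schwartz functions absorbs.
\<close>

lemma schwartz_chirp_decaying_C2:
  assumes "\<phi> \<in> schwartz"
  shows "decaying_C2 (\<lambda>x. cis (p * x\<^sup>2 + q * x) * \<phi> x)"
proof -
  define \<phi>1 where "\<phi>1 = (vderiv ^^ 1) \<phi>"
  define \<phi>2 where "\<phi>2 = (vderiv ^^ 2) \<phi>"
  have d0: "(\<phi> has_vector_derivative \<phi>1 x) (at x)" for x
    using schwartz_has_vector_derivative[OF assms, of 0 x] by (simp add: \<phi>1_def)
  have d1: "(\<phi>1 has_vector_derivative \<phi>2 x) (at x)" for x
    using schwartz_has_vector_derivative[OF assms, of 1 x] by (simp add: \<phi>1_def \<phi>2_def numeral_2_eq_2)
  have qd: "quad_decay (\<lambda>x. of_real x ^ j * \<phi> x)" "quad_decay (\<lambda>x. of_real x ^ j * \<phi>1 x)"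
     "quad_decay (\<lambda>x. of_real x ^ j * \<phi>2 x)" for j
    using schwartz_quad_decay[OF assms, of j 0] schwartz_quad_decay[OF assms, of j 1]
      schwartz_quad_decay[OF assms, of j 2] by (simp_all add: \<phi>1_def \<phi>2_def)
  have c: "continuous_on UNIV \<phi>" "continuous_on UNIV \<phi>1" "continuous_on UNIV \<phi>2"
    using schwartz_continuous[OF assms, of UNIV 0] schwartz_continuous[OF assms, of UNIV 1]
      schwartz_continuous[OF assms, of UNIV 2] by (simp_all add: \<phi>1_def \<phi>2_def)
  define e where "e x = cis (p * x\<^sup>2 + q * x)" for x
  define h where "h x = \<i> * of_real (2 * p * x + q)" for x
  have de: "(e has_vector_derivative h x * e x) (at x)" for x
    unfolding e_def h_def
    by (rule has_vector_derivative_eq_rhs[OF cis_has_vector_derivative[where h' = "2 * p * x + q"]])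
       (auto intro!: derivative_eq_intros)
  have dh: "(h has_vector_derivative (2 * \<i> * p)) (at x)" for x
  proof -
    have "((\<lambda>x. 2 * p * x + q) has_real_derivative 2 * p) (at x)"
      by (rule derivative_eq_intros refl | simp)+
    then have "(h has_vector_derivative (\<i> * of_real (2 * p))) (at x)"
      unfolding h_def by (intro has_vector_derivative_mult_right has_vector_derivative_of_real)
    then show ?thesis by (simp add: mult_ac)
  qed
  define u where "u x = \<phi>1 x + h x * \<phi> x" for x
  define v where "v x = \<phi>2 x + (h x * \<phi>1 x + 2 * \<i> * p * \<phi> x)" for x
  have du: "(u has_vector_derivative v x) (at x)" for x
    unfolding u_def v_def by (intro has_vector_derivative_add has_vector_derivative_mult d0 d1 dh)
  have ce: "continuous_on UNIV e" unfolding e_def by (intro continuous_intros)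
  have ch: "continuous_on UNIV h" unfolding h_def by (intro continuous_intros)
  have cu: "continuous_on UNIV u" "continuous_on UNIV v"
    unfolding u_def v_def by (intro continuous_intros c ch)+
  have const: "quad_decay (\<lambda>x. k * f x)" if "quad_decay f" for k :: complex and f
    using that by (rule quad_decay_bounded_mult[where B = "norm k"]) simp
  have qh: "quad_decay (\<lambda>x. h x * f x)"
    if "quad_decay (\<lambda>x. of_real x * f x)" "quad_decay f" for f
  proof -
    have "quad_decay (\<lambda>x. (2 * \<i> * p) * (of_real x * f x) + \<i> * q * f x)"
      by (intro quad_decay_add const that)
    moreover have "(2 * \<i> * p) * (of_real x * f x) + \<i> * q * f x = h x * f x" for x
      by (simp add: h_def algebra_simps)
    ultimately show ?thesis by simp
  qed
  have q0: "quad_decay \<phi>" "quad_decay \<phi>1" "quad_decay \<phi>2"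
    using qd[of 0] by simp_all
  have q1: "quad_decay (\<lambda>x. of_real x * \<phi> x)" "quad_decay (\<lambda>x. of_real x * \<phi>1 x)"
    using qd[of 1] by simp_all
  have xu: "quad_decay (\<lambda>x. of_real x * u x)"
  proof -
    have "quad_decay (\<lambda>x. of_real x * \<phi>1 x + h x * (of_real x * \<phi> x))"
      using qd(1)[of 2] by (intro quad_decay_add q1 qh) (simp add: power2_eq_square mult.assoc)
    then show ?thesis by (simp add: u_def algebra_simps)
  qed
  have qu: "quad_decay u" unfolding u_def by (intro quad_decay_add q0 qh q1)
  have qv: "quad_decay v" unfolding v_def by (intro quad_decay_add q0 qh q1 const)
  have qe: "quad_decay (\<lambda>x. e x * f x)" if "quad_decay f" for f
    using that by (rule quad_decay_bounded_mult[where B = 1]) (simp add: e_def)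
  define G' where "G' x = e x * u x" for x
  define G'' where "G'' x = e x * (v x + h x * u x)" for x
  have "((\<lambda>x. e x * \<phi> x) has_vector_derivative (e x * \<phi>1 x + h x * e x * \<phi> x)) (at x)" for x
    by (intro has_vector_derivative_mult d0 de)
  then have D1: "((\<lambda>x. e x * \<phi> x) has_vector_derivative G' x) (at x)" for x
    by (simp add: G'_def u_def algebra_simps)
  have "(G' has_vector_derivative (e x * v x + h x * e x * u x)) (at x)" for x
    unfolding G'_def by (intro has_vector_derivative_mult du de)
  then have D2: "(G' has_vector_derivative G'' x) (at x)" for x
    by (simp add: G''_def algebra_simps)
  have "continuous_on UNIV G''" unfolding G''_def by (intro continuous_intros ce ch cu)
  moreover have "quad_decay (\<lambda>x. e x * \<phi> x)" "quad_decay G'" "quad_decay G''"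
    unfolding G'_def G''_def by (intro qe q0 qu qv quad_decay_add qh xu)+
  ultimately show ?thesis
    unfolding decaying_C2_def e_def[symmetric] using D1 D2 by blast
qed

lemma schwartz_lincomb:
  assumes "f \<in> schwartz" "g \<in> schwartz"
  shows "(\<lambda>x. p * f x + q * g x) \<in> schwartz"
proof -
  have iter: "(vderiv ^^ n) (\<lambda>x. p * f x + q * g x) = (\<lambda>x. p * (vderiv ^^ n) f x + q * (vderiv ^^ n) g x)" for n
  proof (induction n)
    case (Suc n)
    have "vector_derivative (\<lambda>x. p * (vderiv ^^ n) f x + q * (vderiv ^^ n) g x) (at x) =
       p * (vderiv ^^ Suc n) f x + q * (vderiv ^^ Suc n) g x" for x
      by (intro vector_derivative_at has_vector_derivative_add has_vector_derivative_mult_right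
            schwartz_has_vector_derivative assms)
    then have "vderiv (\<lambda>x. p * (vderiv ^^ n) f x + q * (vderiv ^^ n) g x) =
       (\<lambda>x. p * (vderiv ^^ Suc n) f x + q * (vderiv ^^ Suc n) g x)"
      unfolding vderiv_def[of "\<lambda>x. p * (vderiv ^^ n) f x + q * (vderiv ^^ n) g x"] by blast
    then show ?case using Suc.IH by (simp only: funpow.simps o_apply)
  qed simp
  have d: "(vderiv ^^ n) f differentiable (at x)" "(vderiv ^^ n) g differentiable (at x)" for n x
    using assms by (auto simp: schwartz_def)
  have b: "bounded (range (\<lambda>x. x ^ j *\<^sub>R (vderiv ^^ n) f x))" "bounded (range (\<lambda>x. x ^ j *\<^sub>R (vderiv ^^ n) g x))" for j n
    using assms by (auto simp: schwartz_def)
  have "bounded (range (\<lambda>x. x ^ j *\<^sub>R (p * (vderiv ^^ n) f x + q * (vderiv ^^ n) g x)))" for j n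
  proof -
    obtain B C where B: "\<And>x. norm (x ^ j *\<^sub>R (vderiv ^^ n) f x) \<le> B"
      and C: "\<And>x. norm (x ^ j *\<^sub>R (vderiv ^^ n) g x) \<le> C"
      using b(1)[of j n] b(2)[of j n] unfolding bounded_iff by blast
    have "norm (p * u + q * v) \<le> norm p * B + norm q * C" if "norm u \<le> B" "norm v \<le> C" for u v :: complex
      using that by (intro norm_triangle_le add_mono) (simp_all add: norm_mult mult_left_mono)
    from this[OF B C] have "norm (p * (x ^ j *\<^sub>R (vderiv ^^ n) f x) + q * (x ^ j *\<^sub>R (vderiv ^^ n) g x)) \<le> norm p * B + norm q * C" for x
      .
    then show ?thesis
      unfolding bounded_iff by (intro exI[of _ "norm p * B + norm q * C"]) (simp add: scaleR_add_right)
  qed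
  then show ?thesis
    using d by (simp add: schwartz_def iter differentiable_add differentiable_mult)
qed

text \<open>
  Being a tempered distribution only concerns values on Schwartz functions. Hence, once the two
  sides of the main identity agree there, only one of them has to be shown continuous.
\<close>

lemma tempered_distribution_cong:
  assumes v: "tempered_distribution v" and eq: "\<And>\<phi>. \<phi> \<in> schwartz \<Longrightarrow> u \<phi> = v \<phi>"
  shows "tempered_distribution u"
  using v unfolding tempered_distribution_def
  by (simp add: eq schwartz_lincomb cong: ball_cong)

text \<open>
  Bounded weights on a lattice define a functional dominated by the seminorms with indices
  \<open>(0, 0)\<close> and \<open>(2, 0)\<close>, because these control \<open>(1 + x\<^sup>2) \<phi> x\<close>.
\<close>

lemma tempered_distribution_lattice_sum:
  fixes c :: complex and w :: "int \<Rightarrow> complex" and s \<theta> :: real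
  assumes "s > 0" and w: "\<And>k. norm (w k) \<le> 1"
  shows "tempered_distribution (\<lambda>\<phi>. c * (\<Sum>\<^sub>\<infinity>k::int. w k * \<phi> ((k + \<theta>) / s)))"
proof -
  have sm: "(\<lambda>k::int. norm (w k * \<phi> ((k + \<theta>) / s))) summable_on UNIV" if "quad_decay \<phi>" for \<phi>
  proof (rule summable_on_comparison_test)
    show "(\<lambda>k::int. norm (\<phi> ((k + \<theta>) / s))) summable_on UNIV"
      using quad_decay_summable[OF quad_decay_affine[OF that]] assms by auto
    show "norm (w k * \<phi> ((k + \<theta>) / s)) \<le> norm (\<phi> ((k + \<theta>) / s))" for k
      using mult_right_mono[OF w] by (simp add: norm_mult)
  qed simp
  have smc: "(\<lambda>k::int. w k * \<phi> ((k + \<theta>) / s)) summable_on UNIV" if "\<phi> \<in> schwartz" for \<phi>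
    using sm[OF schwartz_quad_decay_self[OF that]] by (rule abs_summable_summable)
  define K where "K = (\<Sum>\<^sub>\<infinity>k::int. 1 / (1 + ((k + \<theta>) / s)\<^sup>2))"
  have inv_decay: "quad_decay (\<lambda>x. of_real (1 / (1 + x\<^sup>2)))"
    by (rule quad_decayI[of _ 1]) (use one_plus_square_pos in \<open>simp add: norm_divide flip: of_real_add of_real_power\<close>)
  have smK: "(\<lambda>k::int. 1 / (1 + ((k + \<theta>) / s)\<^sup>2)) summable_on UNIV"
  proof -
    have "norm (complex_of_real (1 / (1 + x\<^sup>2))) = 1 / (1 + x\<^sup>2)" for x :: real
      using one_plus_square_pos[of x] by (simp only: norm_of_real) simp
    moreover have "(\<lambda>k::int. norm (complex_of_real (1 / (1 + ((k + \<theta>) / s)\<^sup>2)))) summable_on UNIV"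
      using assms(1) by (intro quad_decay_summable[OF quad_decay_affine[OF inv_decay]]) simp
    ultimately show ?thesis by (simp only:)
  qed
  have lin: "(\<Sum>\<^sub>\<infinity>k::int. w k * (p * f ((k + \<theta>) / s) + q * g ((k + \<theta>) / s))) =
      p * (\<Sum>\<^sub>\<infinity>k::int. w k * f ((k + \<theta>) / s)) + q * (\<Sum>\<^sub>\<infinity>k::int. w k * g ((k + \<theta>) / s))"
    if "f \<in> schwartz" "g \<in> schwartz" for f g p q
  proof -
    have "(\<Sum>\<^sub>\<infinity>k::int. w k * (p * f ((k + \<theta>) / s) + q * g ((k + \<theta>) / s))) =
       (\<Sum>\<^sub>\<infinity>k::int. p * (w k * f ((k + \<theta>) / s)) + q * (w k * g ((k + \<theta>) / s)))"
      by (simp add: algebra_simps)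
    also have "\<dots> = (\<Sum>\<^sub>\<infinity>k::int. p * (w k * f ((k + \<theta>) / s))) + (\<Sum>\<^sub>\<infinity>k::int. q * (w k * g ((k + \<theta>) / s)))"
      by (rule infsum_add[OF summable_on_cmult_right[OF smc[OF that(1)]] summable_on_cmult_right[OF smc[OF that(2)]]])
    finally show ?thesis by (simp add: infsum_cmult_right')
  qed
  have semi: "norm (x ^ j *\<^sub>R \<psi> x) \<le> schwartz_seminorm j 0 \<psi>" if "\<psi> \<in> schwartz" for \<psi> j x
  proof -
    have "bounded (range (\<lambda>x. x ^ j *\<^sub>R (vderiv ^^ 0) \<psi> x))"
      using that unfolding schwartz_def by blast
    then have "bdd_above (range (\<lambda>x. norm (x ^ j *\<^sub>R \<psi> x)))"
      unfolding bounded_iff bdd_above_def by auto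
    then show ?thesis
      unfolding schwartz_seminorm_def funpow.simps id_apply by (intro cSUP_upper UNIV_I)
  qed
  have bound: "norm (\<Sum>\<^sub>\<infinity>k::int. w k * \<psi> ((k + \<theta>) / s)) \<le> (schwartz_seminorm 0 0 \<psi> + schwartz_seminorm 2 0 \<psi>) * K"
    if "\<psi> \<in> schwartz" for \<psi>
  proof -
    have pt: "norm (w k * \<psi> ((k + \<theta>) / s)) \<le> (schwartz_seminorm 0 0 \<psi> + schwartz_seminorm 2 0 \<psi>) * (1 / (1 + ((k + \<theta>) / s)\<^sup>2))" for k :: int
    proof -
      define x where "x = (k + \<theta>) / s"
      have "norm (\<psi> x) * (1 + x\<^sup>2) \<le> schwartz_seminorm 0 0 \<psi> + schwartz_seminorm 2 0 \<psi>"
        using semi[OF that, of x 0] semi[OF that, of x 2] by (simp add: ring_distribs mult.commute)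
      then have "norm (\<psi> x) \<le> (schwartz_seminorm 0 0 \<psi> + schwartz_seminorm 2 0 \<psi>) * (1 / (1 + x\<^sup>2))"
        using one_plus_square_pos[of x] by (simp add: pos_le_divide_eq)
      moreover have "norm (w k * \<psi> x) \<le> norm (\<psi> x)"
        using mult_right_mono[OF w] by (simp add: norm_mult)
      ultimately show ?thesis unfolding x_def by linarith
    qed
    have "norm (\<Sum>\<^sub>\<infinity>k::int. w k * \<psi> ((k + \<theta>) / s)) \<le>
        (\<Sum>\<^sub>\<infinity>k::int. (schwartz_seminorm 0 0 \<psi> + schwartz_seminorm 2 0 \<psi>) * (1 / (1 + ((k + \<theta>) / s)\<^sup>2)))"
      using pt by (intro norm_infsum_le[OF has_sum_infsum[OF smc[OF that]] has_sum_infsum[OF summable_on_cmult_right[OF smK]]]) auto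
    then show ?thesis by (simp only: infsum_cmult_right' K_def)
  qed
  have K0: "K \<ge> 0" unfolding K_def by (intro infsum_nonneg) simp
  show ?thesis
    unfolding tempered_distribution_def
  proof (intro conjI ballI allI impI)
    fix f g :: "real \<Rightarrow> complex" and p q assume "f \<in> schwartz" "g \<in> schwartz"
    then show "c * (\<Sum>\<^sub>\<infinity>k::int. w k * (p * f ((k + \<theta>) / s) + q * g ((k + \<theta>) / s))) =
      p * (c * (\<Sum>\<^sub>\<infinity>k::int. w k * f ((k + \<theta>) / s))) + q * (c * (\<Sum>\<^sub>\<infinity>k::int. w k * g ((k + \<theta>) / s)))"
      unfolding lin[OF \<open>f \<in> schwartz\<close> \<open>g \<in> schwartz\<close>] by (simp add: algebra_simps)
  next
    fix f :: "real \<Rightarrow> complex" and \<epsilon> :: real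
    assume f: "f \<in> schwartz" and \<epsilon>: "\<epsilon> > 0"
    define M where "M = norm c * K * 2 + 1"
    have M: "M > 0" unfolding M_def using K0 by (simp add: add_nonneg_pos)
    have "norm (c * (\<Sum>\<^sub>\<infinity>k::int. w k * g ((k + \<theta>) / s)) - c * (\<Sum>\<^sub>\<infinity>k::int. w k * f ((k + \<theta>) / s))) < \<epsilon>"
      if g: "g \<in> schwartz" and small: "\<forall>j\<le>2. \<forall>n\<le>2. schwartz_seminorm j n (\<lambda>x. g x - f x) < \<epsilon> / M" for g
    proof -
      define \<psi> where "\<psi> x = g x - f x" for x
      have \<psi>: "\<psi> \<in> schwartz" using schwartz_lincomb[OF g f, of 1 "-1"] by (simp add: \<psi>_def[abs_def])
      have "(\<Sum>\<^sub>\<infinity>k::int. w k * g ((k + \<theta>) / s)) - (\<Sum>\<^sub>\<infinity>k::int. w k * f ((k + \<theta>) / s)) =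
         (\<Sum>\<^sub>\<infinity>k::int. w k * \<psi> ((k + \<theta>) / s))"
        using lin[OF g f, of 1 "-1"] by (simp add: \<psi>_def)
      then have "norm (c * (\<Sum>\<^sub>\<infinity>k::int. w k * g ((k + \<theta>) / s)) - c * (\<Sum>\<^sub>\<infinity>k::int. w k * f ((k + \<theta>) / s))) =
         norm c * norm (\<Sum>\<^sub>\<infinity>k::int. w k * \<psi> ((k + \<theta>) / s))"
        by (simp add: norm_mult flip: right_diff_distrib)
      also have "\<dots> \<le> norm c * ((schwartz_seminorm 0 0 \<psi> + schwartz_seminorm 2 0 \<psi>) * K)"
        by (intro mult_left_mono bound \<psi>) simp
      also have "\<dots> \<le> norm c * ((\<epsilon> / M + \<epsilon> / M) * K)"
        using small K0 by (intro mult_left_mono mult_right_mono add_mono) (auto simp: \<psi>_def[abs_def] less_imp_le)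
      also have "\<dots> = (M - 1) * (\<epsilon> / M)" by (simp add: M_def algebra_simps)
      also have "\<dots> < M * (\<epsilon> / M)" using M \<epsilon> by (intro mult_strict_right_mono) auto
      also have "\<dots> = \<epsilon>" using M by simp
      finally show ?thesis .
    qed
    then show "\<exists>\<delta>>0. \<exists>N. \<forall>g\<in>schwartz. (\<forall>j\<le>N. \<forall>n\<le>N. schwartz_seminorm j n (\<lambda>x. g x - f x) < \<delta>) \<longrightarrow>
        norm (c * (\<Sum>\<^sub>\<infinity>k::int. w k * g ((k + \<theta>) / s)) - c * (\<Sum>\<^sub>\<infinity>k::int. w k * f ((k + \<theta>) / s))) < \<epsilon>"
      using M \<epsilon> by (intro exI[of _ "\<epsilon> / M"] conjI exI[of _ 2]) auto
  qed
qed

section \<open>Residue classes and quadratic Gauss sums\<close>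

lemma infsum_int_residues:
  fixes f :: "int \<Rightarrow> complex"
  assumes "b \<noteq> 0" "f summable_on UNIV"
  shows "infsum f UNIV = (\<Sum>j\<in>{0..<\<bar>b\<bar>}. \<Sum>\<^sub>\<infinity>m. f (j + b * m))"
proof -
  have inj: "inj (\<lambda>m. j + b * m)" for j
    using assms(1) by (auto intro: injI)
  have "(\<Union>j\<in>{0..<\<bar>b\<bar>}. range (\<lambda>m. j + b * m)) = UNIV"
  proof (intro equalityI subsetI UNIV_I)
    fix n :: int
    have "n = n mod \<bar>b\<bar> + b * (sgn b * (n div \<bar>b\<bar>))"
      by (metis abs_sgn mult.assoc mult.commute mod_mult_div_eq)
    moreover have "n mod \<bar>b\<bar> \<in> {0..<\<bar>b\<bar>}" using assms(1) by simp
    ultimately show "n \<in> (\<Union>j\<in>{0..<\<bar>b\<bar>}. range (\<lambda>m. j + b * m))" by blast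
  qed
  moreover have "range (\<lambda>m. i + b * m) \<inter> range (\<lambda>m. j + b * m) = {}"
    if "i \<in> {0..<\<bar>b\<bar>}" "j \<in> {0..<\<bar>b\<bar>}" "i \<noteq> j" for i j
  proof (rule ccontr)
    assume "\<not> ?thesis"
    then obtain m n where "i + b * m = j + b * n" by blast
    then have "i - j = b * (n - m)" by (simp add: algebra_simps)
    then have "\<bar>b\<bar> dvd i - j" by simp
    then have "i mod \<bar>b\<bar> = j mod \<bar>b\<bar>" by (simp add: mod_eq_dvd_iff)
    then show False using that by simp
  qed
  ultimately have "infsum f UNIV = (\<Sum>j\<in>{0..<\<bar>b\<bar>}. infsum f (range (\<lambda>m. j + b * m)))"
    using sum_infsum[of "{0..<\<bar>b\<bar>}" f "\<lambda>j. range (\<lambda>m. j + b * m)"] assms(2) summable_on_subset_banach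
    by (metis (no_types, lifting) finite_atLeastLessThan_int subset_UNIV)
  also have "\<dots> = (\<Sum>j\<in>{0..<\<bar>b\<bar>}. \<Sum>\<^sub>\<infinity>m. f (j + b * m))"
    using infsum_reindex[OF inj, of f] by (simp add: o_def)
  finally show ?thesis .
qed

lemma infsum_sum_swap:
  fixes f :: "'i \<Rightarrow> 'k \<Rightarrow> complex"
  assumes "finite J" "\<And>j. j \<in> J \<Longrightarrow> f j summable_on A"
  shows "(\<Sum>j\<in>J. \<Sum>\<^sub>\<infinity>k\<in>A. f j k) = (\<Sum>\<^sub>\<infinity>k\<in>A. \<Sum>j\<in>J. f j k)"
proof -
  have "((\<lambda>k. \<Sum>j\<in>J. f j k) has_sum (\<Sum>j\<in>J. infsum (f j) A)) A"
    using assms by (induction J rule: finite_induct) (auto intro!: has_sum_add)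
  then show ?thesis by (simp add: infsumI)
qed

text \<open>
  The additive character \<open>exp (\<pi> i x / b)\<close> of the integers mod \<open>2 b\<close>. The half period is needed since
  \<open>a j\<^sup>2\<close> enters the weights without a factor \<open>2\<close>.
\<close>

definition half_char :: "int \<Rightarrow> int \<Rightarrow> complex" where
  "half_char b x = cis (pi * of_int x / of_int b)"

lemma half_char_add: "half_char b (x + y) = half_char b x * half_char b y"
  by (simp add: half_char_def cis_mult ring_distribs add_divide_distrib)

lemma cis_2pi_int: "cis (2 * pi * of_int n) = 1"
  by (simp add: complex_eq_iff cos_int_2pin sin_int_2pin)

lemma half_char_shift:
  assumes "b \<noteq> 0"
  shows "half_char b (x + 2 * b * n) = half_char b x"
proof -
  have "pi * of_int (2 * b * n) / of_int b = 2 * pi * of_int n"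
    using assms by simp
  then have "half_char b (2 * b * n) = 1"
    unfolding half_char_def by (simp only: cis_2pi_int)
  then show ?thesis by (simp add: half_char_add)
qed

lemma half_char_even: "even n \<Longrightarrow> b \<noteq> 0 \<Longrightarrow> half_char b (x + b * n) = half_char b x"
  using half_char_shift[of b x] by (auto elim!: evenE simp: mult_ac)

lemma norm_half_char [simp]: "norm (half_char b x) = 1"
  by (simp add: half_char_def)

lemma half_char_eq_1D:
  assumes "half_char b x = 1" "b \<noteq> 0"
  shows "2 * b dvd x"
proof -
  have "cos (pi * of_int x / of_int b) = 1"
    using assms(1) by (simp add: half_char_def complex_eq_iff)
  then obtain n :: int where "pi * of_int x / of_int b = of_int n * 2 * pi"
    by (auto simp: cos_one_2pi_int)
  then have "real_of_int x = real_of_int (2 * b * n)"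
    using assms(2) by (simp add: field_simps)
  then have "x = 2 * b * n" using of_int_eq_iff by blast
  then show ?thesis by simp
qed

text \<open>A sum over a full period does not depend on where the period starts, whatever the sign of \<open>b\<close>.\<close>

lemma sum_residues_shift:
  fixes f :: "int \<Rightarrow> 'a :: comm_monoid_add"
  assumes "b \<noteq> 0" and per: "\<And>j. f (j + b) = f j"
  shows "(\<Sum>j\<in>{0..<\<bar>b\<bar>}. f (j + m)) = (\<Sum>j\<in>{0..<\<bar>b\<bar>}. f j)"
proof -
  have nat: "f (j + b * int n) = f j" for j n
  proof (induction n)
    case (Suc n)
    show ?case using per[of "j + b * int n"] Suc by (simp add: algebra_simps)
  qed simp
  have int: "f (j + b * n) = f j" for j n
  proof (cases "n \<ge> 0")
    case True
    then show ?thesis using nat[of j "nat n"] by simp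
  next
    case False
    then show ?thesis using nat[of "j + b * n" "nat (- n)"] by simp
  qed
  have md: "f (j mod \<bar>b\<bar>) = f j" for j
  proof -
    have "j = j mod \<bar>b\<bar> + b * (sgn b * (j div \<bar>b\<bar>))"
      by (metis abs_sgn mult.assoc mult.commute mod_mult_div_eq)
    then show ?thesis using int by metis
  qed
  show ?thesis
    by (rule sum.reindex_bij_witness[of _ "\<lambda>j. (j - m) mod \<bar>b\<bar>" "\<lambda>j. (j + m) mod \<bar>b\<bar>"])
       (use assms(1) md in \<open>auto simp: mod_simps\<close>)
qed

text \<open>
  The term \<open>- a b j\<close> compensates for the sign by which \<open>half_char b (a * j\<^sup>2)\<close> changes under
  \<open>j \<mapsto> j + b\<close> when \<open>a b\<close> is odd: with it, the summand has period \<open>b\<close> in \<open>j\<close>.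
\<close>

definition chirp_gauss_sum :: "int \<Rightarrow> int \<Rightarrow> int \<Rightarrow> complex" where
  "chirp_gauss_sum a b k = (\<Sum>j\<in>{0..<\<bar>b\<bar>}. half_char b (a * j\<^sup>2 - 2 * j * k - a * b * j))"

text \<open>
  Replacing \<open>j\<close> by \<open>j + d k\<close> turns \<open>a j\<^sup>2\<close> into \<open>a j\<^sup>2 + 2 a d j k + \<dots>\<close>, and \<open>2 a d j k\<close> cancels
  \<open>- 2 j k\<close> mod \<open>2 b\<close> since \<open>a d = 1 + b c\<close>. What remains besides the sum for \<open>k = 0\<close> does not depend
  on \<open>j\<close>.
\<close>

lemma chirp_gauss_sum_eq:
  assumes "b \<noteq> 0" "a * d - b * c = (1::int)"
  shows "chirp_gauss_sum a b k = chirp_gauss_sum a b 0 * half_char b (d * (b * c - 1) * k\<^sup>2 - a * b * d * k)"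
proof -
  define q where "q j = a * j\<^sup>2 - 2 * j * k - a * b * j" for j
  have per: "half_char b (q (j + b)) = half_char b (q j)" for j
  proof -
    have "q (j + b) = q j + 2 * b * (a * j - k)"
      by (simp add: q_def power2_eq_square algebra_simps)
    then show ?thesis using assms(1) by (simp add: half_char_shift)
  qed
  have "q (j + d * k) = (a * j\<^sup>2 - 2 * j * 0 - a * b * j) + (d * (b * c - 1) * k\<^sup>2 - a * b * d * k) + 2 * b * (c * j * k)" for j
  proof -
    have ad: "a * d = 1 + b * c" using assms(2) by simp
    have "q (j + d * k) = a * j\<^sup>2 + 2 * (a * d) * j * k + (a * d) * d * k\<^sup>2 - 2 * j * k - 2 * d * k\<^sup>2 - a * b * j - a * b * d * k"
      by (simp add: q_def power2_eq_square algebra_simps)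
    then show ?thesis unfolding ad by (simp add: power2_eq_square algebra_simps)
  qed
  then have "half_char b (q (j + d * k)) =
      half_char b ((a * j\<^sup>2 - 2 * j * 0 - a * b * j) + (d * (b * c - 1) * k\<^sup>2 - a * b * d * k))" for j
    by (simp only: half_char_shift[OF assms(1)])
  then have "half_char b (q (j + d * k)) = half_char b (a * j\<^sup>2 - 2 * j * 0 - a * b * j) * half_char b (d * (b * c - 1) * k\<^sup>2 - a * b * d * k)" for j
    by (simp only: half_char_add)
  then have "(\<Sum>j\<in>{0..<\<bar>b\<bar>}. half_char b (q (j + d * k))) = chirp_gauss_sum a b 0 * half_char b (d * (b * c - 1) * k\<^sup>2 - a * b * d * k)"
    by (simp only: chirp_gauss_sum_def sum_distrib_right)
  moreover have "(\<Sum>j\<in>{0..<\<bar>b\<bar>}. half_char b (q (j + d * k))) = chirp_gauss_sum a b k"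
    using sum_residues_shift[OF assms(1), of "\<lambda>j. half_char b (q j)"] per by (simp add: chirp_gauss_sum_def q_def)
  ultimately show ?thesis by simp
qed

text \<open>A shift by one multiplies the sum by a nontrivial root of unity without changing it.\<close>

lemma sum_half_char_eq_0:
  assumes "b \<noteq> 0" "\<not> b dvd j"
  shows "(\<Sum>k\<in>{0..<\<bar>b\<bar>}. half_char b (- 2 * j * k)) = 0"
proof -
  have "half_char b (- 2 * j * (k + b)) = half_char b (- 2 * j * k)" for k
    using half_char_shift[OF assms(1), of "- 2 * j * k" "- j"] by (simp add: algebra_simps)
  then have "(\<Sum>k\<in>{0..<\<bar>b\<bar>}. half_char b (- 2 * j * k)) = (\<Sum>k\<in>{0..<\<bar>b\<bar>}. half_char b (- 2 * j * (k + 1)))"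
    using sum_residues_shift[OF assms(1), of "\<lambda>k. half_char b (- 2 * j * k)" 1] by simp
  also have "\<dots> = half_char b (- 2 * j) * (\<Sum>k\<in>{0..<\<bar>b\<bar>}. half_char b (- 2 * j * k))"
    unfolding sum_distrib_left half_char_add[symmetric] by (simp add: algebra_simps)
  finally have "half_char b (- 2 * j) = 1 \<or> (\<Sum>k\<in>{0..<\<bar>b\<bar>}. half_char b (- 2 * j * k)) = 0"
    by auto
  moreover have "half_char b (- 2 * j) \<noteq> 1"
    using half_char_eq_1D[of b "- 2 * j"] assms by auto
  ultimately show ?thesis by blast
qed

text \<open>
  By orthogonality of characters, summing over all \<open>k\<close> leaves only the term \<open>j = 0\<close>, so the total is
  \<open>\<bar>b\<bar>\<close>; but if one of these sums vanishes at \<open>k = 0\<close>, all of them vanish.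
\<close>

lemma chirp_gauss_sum_nonzero:
  assumes "b \<noteq> 0" "a * d - b * c = (1::int)"
  shows "chirp_gauss_sum a b 0 \<noteq> 0"
proof
  assume "chirp_gauss_sum a b 0 = 0"
  then have "chirp_gauss_sum a b k = 0" for k
    by (subst chirp_gauss_sum_eq[OF assms]) simp
  then have "0 = (\<Sum>k\<in>{0..<\<bar>b\<bar>}. chirp_gauss_sum a b k)" by simp
  also have "\<dots> = (\<Sum>j\<in>{0..<\<bar>b\<bar>}. \<Sum>k\<in>{0..<\<bar>b\<bar>}. half_char b (a * j\<^sup>2 - 2 * j * k - a * b * j))"
    unfolding chirp_gauss_sum_def by (rule sum.swap)
  also have "\<dots> = (\<Sum>j\<in>{0..<\<bar>b\<bar>}. half_char b (a * j\<^sup>2 - a * b * j) * (\<Sum>k\<in>{0..<\<bar>b\<bar>}. half_char b (- 2 * j * k)))"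
    unfolding sum_distrib_left half_char_add[symmetric]
    by (intro sum.cong refl arg_cong[where f = "half_char b"]) simp
  also have "\<dots> = (\<Sum>j\<in>{0..<\<bar>b\<bar>}. if j = 0 then of_int \<bar>b\<bar> else 0)"
  proof (rule sum.cong[OF refl])
    fix j assume j: "j \<in> {0..<\<bar>b\<bar>}"
    show "half_char b (a * j\<^sup>2 - a * b * j) * (\<Sum>k\<in>{0..<\<bar>b\<bar>}. half_char b (- 2 * j * k)) = (if j = 0 then of_int \<bar>b\<bar> else 0)"
    proof (cases "j = 0")
      case True
      then show ?thesis by (simp add: half_char_def)
    next
      case False
      then have "\<not> b dvd j" using j zdvd_not_zless[of j "\<bar>b\<bar>"] by auto
      from sum_half_char_eq_0[OF assms(1) this] show ?thesis using False by simp
    qed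
  qed
  also have "\<dots> = of_int \<bar>b\<bar>" using assms(1) by (simp add: sum.delta)
  finally show False using assms(1) by simp
qed

section \<open>The transform of the Dirac comb\<close>

text \<open>
  Reducing the exponent by \<open>2 k\<close> changes the sign of both \<open>sin\<close> and \<open>cos\<close> by \<open>(-1)^k\<close>, which the
  reflection of the argument undoes in the kernel. So one integral formula, up to a constant, covers
  all exponents that are not even integers.
\<close>

lemma frft_integral_formula:
  assumes "sin (pi * \<alpha> / 2) \<noteq> 0"
  shows "\<exists>C. C \<noteq> 0 \<and> (\<forall>\<phi> x. frft \<alpha> \<phi> x = C * (LBINT y. frft_kernel \<alpha> x y * \<phi> y))"
proof -
  define k where "k = frft_shift \<alpha>"
  define \<beta> where "\<beta> = \<alpha> - 2 * of_int k"
  define \<epsilon> :: real where "\<epsilon> = (- 1) powi k"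
  have e2: "\<epsilon> * \<epsilon> = 1" by (cases "even k") (simp_all add: \<epsilon>_def)
  have arg: "pi * \<beta> / 2 = pi * \<alpha> / 2 - of_int k * pi" by (simp add: \<beta>_def field_simps)
  have sc: "sin (pi * \<beta> / 2) = \<epsilon> * sin (pi * \<alpha> / 2)" "cos (pi * \<beta> / 2) = \<epsilon> * cos (pi * \<alpha> / 2)"
  proof -
    have "sin (of_int k * pi) = 0" by (simp add: sin_zero_iff_int2)
    moreover have "cos (of_int k * pi) = \<epsilon>"
    proof (cases "even k")
      case True
      then obtain m where m: "k = 2 * m" by blast
      have "of_int k * pi = 2 * pi * of_int m" by (simp add: m)
      then show ?thesis using True by (simp only: cos_int_2pin \<epsilon>_def) simp
    next
      case False
      then obtain m where m: "k = 2 * m + 1" by (blast elim: oddE)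
      have "of_int k * pi = 2 * pi * of_int m + pi" by (simp add: m algebra_simps)
      then show ?thesis using False by (simp only: cos_periodic_pi cos_int_2pin \<epsilon>_def) simp
    qed
    ultimately show "sin (pi * \<beta> / 2) = \<epsilon> * sin (pi * \<alpha> / 2)" "cos (pi * \<beta> / 2) = \<epsilon> * cos (pi * \<alpha> / 2)"
      unfolding arg sin_diff cos_diff by simp_all
  qed
  have \<epsilon>0: "\<epsilon> \<noteq> 0" using e2 by auto
  have \<beta>0: "\<beta> \<noteq> 0" using sc(1) assms \<epsilon>0 by auto
  have ker: "frft_kernel \<beta> (\<epsilon> * x) y = frft_kernel \<alpha> x y" for x y
  proof -
    have "pi / (\<epsilon> * sin (pi * \<alpha> / 2)) * (\<epsilon> * cos (pi * \<alpha> / 2) * ((\<epsilon> * x)\<^sup>2 + y\<^sup>2) - 2 * (\<epsilon> * x) * y) =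
      pi / sin (pi * \<alpha> / 2) * (cos (pi * \<alpha> / 2) * (x\<^sup>2 + y\<^sup>2) - 2 * x * y)"
    proof -
      have "(\<epsilon> * x)\<^sup>2 = x\<^sup>2" using e2 by (simp add: power_mult_distrib power2_eq_square)
      then have "\<epsilon> * cos (pi * \<alpha> / 2) * ((\<epsilon> * x)\<^sup>2 + y\<^sup>2) - 2 * (\<epsilon> * x) * y = \<epsilon> * (cos (pi * \<alpha> / 2) * (x\<^sup>2 + y\<^sup>2) - 2 * x * y)"
        by (simp only:) (simp add: algebra_simps)
      then show ?thesis using \<epsilon>0 by simp
    qed
    then show ?thesis unfolding frft_kernel_def sc by (rule arg_cong)
  qed
  define C where "C = exp (- (\<i> * of_real pi / 2 * of_int k)) * (1 / csqrt (\<i> * of_real (sin (pi * \<beta> / 2))))"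
  have "C \<noteq> 0" using sc(1) assms \<epsilon>0 by (simp add: C_def)
  moreover have "frft \<alpha> \<phi> x = C * (LBINT y. frft_kernel \<alpha> x y * \<phi> y)" for \<phi> x
    using \<beta>0 unfolding frft_def Let_def k_def[symmetric] \<beta>_def[symmetric] \<epsilon>_def[symmetric] frft_base_def C_def ker
    by simp
  ultimately show ?thesis by blast
qed

lemma angle_components:
  assumes "r > 0" "s > 0"
    and "exp (complex_of_real pi * \<i> / 2 * complex_of_real \<alpha>) =
           1 / complex_of_real s *
             (of_int a / complex_of_real r + \<i> * of_int b * complex_of_real r)"
  shows "cos (pi * \<alpha> / 2) = of_int a / (r * s)" "sin (pi * \<alpha> / 2) = of_int b * r / s"
    "s\<^sup>2 = (of_int a)\<^sup>2 / r\<^sup>2 + (of_int b)\<^sup>2 * r\<^sup>2"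
proof -
  have "exp (complex_of_real pi * \<i> / 2 * complex_of_real \<alpha>) = cis (pi * \<alpha> / 2)"
    unfolding cis_conv_exp by (rule arg_cong[where f = exp]) simp
  moreover have "1 / complex_of_real s * (of_int a / complex_of_real r + \<i> * of_int b * complex_of_real r) =
     Complex (of_int a / (r * s)) (of_int b * r / s)"
    using assms(1,2) by (simp add: complex_eq_iff)
  ultimately have *: "cis (pi * \<alpha> / 2) = Complex (of_int a / (r * s)) (of_int b * r / s)"
    using assms(3) by simp
  show cs: "cos (pi * \<alpha> / 2) = of_int a / (r * s)" "sin (pi * \<alpha> / 2) = of_int b * r / s"
    using arg_cong[OF *, of Re] arg_cong[OF *, of Im] by simp_all
  have "(of_int a / (r * s))\<^sup>2 + (of_int b * r / s)\<^sup>2 = 1"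
    using sin_cos_squared_add2[of "pi * \<alpha> / 2"] unfolding cs by simp
  then show "s\<^sup>2 = (of_int a)\<^sup>2 / r\<^sup>2 + (of_int b)\<^sup>2 * r\<^sup>2"
    using assms(1,2) by (simp add: power_divide power_mult_distrib field_simps)
qed

lemma frft_kernel_lattice:
  assumes "r > 0" "s > 0" "b \<noteq> 0"
    and "cos (pi * \<alpha> / 2) = of_int a / (r * s)" "sin (pi * \<alpha> / 2) = of_int b * r / s"
  shows "frft_kernel \<alpha> (r * of_int n) y =
    half_char b (a * n\<^sup>2) * (cis (- 2 * pi * (s * of_int n / of_int b) * y) * cis (pi * of_int a / (of_int b * r\<^sup>2) * y\<^sup>2))"
proof -
  have "pi / (of_int b * r / s) * (of_int a / (r * s) * ((r * of_int n)\<^sup>2 + y\<^sup>2) - 2 * (r * of_int n) * y) =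
     pi * of_int (a * n\<^sup>2) / of_int b + (- 2 * pi * (s * of_int n / of_int b) * y + pi * of_int a / (of_int b * r\<^sup>2) * y\<^sup>2)"
    using assms(1-3) by (simp add: field_simps power2_eq_square)
  then show ?thesis
    unfolding frft_kernel_def assms(4,5) half_char_def cis_mult
    unfolding cis_conv_exp by (simp only:)
qed

text \<open>
  The index is written as \<open>j + b m\<close>. On the class of \<open>j\<close> the weight is a constant times
  \<open>exp (2 \<pi> i \<theta> m)\<close> with \<open>\<theta> = a b / 2\<close>, and raising the frequency \<open>s m\<close> by \<open>s j / b\<close>
  amounts to modulating \<open>g\<close>, which gives the function \<open>G\<close> of the proof. Twisted Poisson summation applies, and at the point \<open>y k\<close> the
  modulation supplies the remaining terms of the summand of the Gauss sum.
\<close>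

lemma sum_chirp_fourier:
  fixes a b :: int and s p :: real
  assumes \<phi>: "\<phi> \<in> schwartz" and "b \<noteq> 0" "s > 0"
  defines "g \<equiv> \<lambda>y. cis (p * y\<^sup>2) * \<phi> y"
  shows "(\<Sum>\<^sub>\<infinity>n::int. half_char b (a * n\<^sup>2) * fourier g (s * of_int n / of_int b)) =
    1 / s * (\<Sum>\<^sub>\<infinity>k::int. chirp_gauss_sum a b k * g ((of_int k + of_int (a * b) / 2) / s))"
proof -
  define \<theta> :: real where "\<theta> = of_int (a * b) / 2"
  define y where "y k = (of_int k + \<theta>) / s" for k :: int
  define f where "f n = half_char b (a * n\<^sup>2) * fourier g (s * of_int n / of_int b)" for n
  have gC2: "decaying_C2 g"
    using schwartz_chirp_decaying_C2[OF \<phi>, of p 0] by (simp add: g_def)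
  have "(\<lambda>n. norm (f n)) summable_on UNIV"
  proof -
    have "(\<lambda>n::int. norm (fourier g ((of_int n + 0) / (of_int b / s)))) summable_on UNIV"
      using assms by (intro quad_decay_summable[OF quad_decay_affine[OF quad_decay_fourier[OF gC2]]]) auto
    then show ?thesis by (simp add: f_def norm_mult mult.commute)
  qed
  then have "infsum f UNIV = (\<Sum>j\<in>{0..<\<bar>b\<bar>}. \<Sum>\<^sub>\<infinity>m. f (j + b * m))"
    using infsum_int_residues[OF assms(2)] abs_summable_summable by blast
  also have "\<dots> = (\<Sum>j\<in>{0..<\<bar>b\<bar>}. \<Sum>\<^sub>\<infinity>k::int. 1 / s * (half_char b (a * j\<^sup>2 - 2 * j * k - a * b * j) * g (y k)))"
  proof (rule sum.cong[OF refl])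
    fix j :: int
    define G where "G x = cis (p * x\<^sup>2 + (- 2 * pi * (s * of_int j / of_int b)) * x) * \<phi> x" for x
    have G: "G x = cis (- 2 * pi * (s * of_int j / of_int b) * x) * g x" for x
      by (simp add: G_def g_def cis_mult add.commute flip: mult.assoc)
    have "decaying_C2 G" unfolding G_def by (rule schwartz_chirp_decaying_C2[OF \<phi>])
    have shift: "fourier g (s * of_int (j + b * m) / of_int b) = fourier G (s * of_int m)" for m
    proof -
      have "cis (- 2 * pi * (s * of_int (j + b * m) / of_int b) * x) =
          cis (- 2 * pi * (s * of_int m) * x) * cis (- 2 * pi * (s * of_int j / of_int b) * x)" for x
        using assms(2) unfolding cis_mult by (intro arg_cong[where f = cis]) (simp add: field_simps)
      then show ?thesis unfolding fourier_def G by (simp only: mult.assoc)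
    qed
    have char: "half_char b (a * (j + b * m)\<^sup>2) = half_char b (a * j\<^sup>2) * cis (2 * pi * \<theta> * of_int m)" for m
    proof -
      have "a * (j + b * m)\<^sup>2 = (a * j\<^sup>2 + b * (a * b * m)) + b * (2 * a * j * m + a * b * (m * (m - 1)))"
        by (simp add: power2_eq_square algebra_simps)
      moreover have "even (2 * a * j * m + a * b * (m * (m - 1)))" by simp
      ultimately have "half_char b (a * (j + b * m)\<^sup>2) = half_char b (a * j\<^sup>2 + b * (a * b * m))"
        using half_char_even[OF _ assms(2)] by presburger
      then have "half_char b (a * (j + b * m)\<^sup>2) = half_char b (a * j\<^sup>2) * half_char b (b * (a * b * m))"
        by (simp only: half_char_add)
      moreover have "half_char b (b * (a * b * m)) = cis (2 * pi * \<theta> * of_int m)"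
        using assms(2) by (simp add: half_char_def \<theta>_def mult_ac)
      ultimately show ?thesis by simp
    qed
    have summand: "half_char b (a * j\<^sup>2) * G (y k) = half_char b (a * j\<^sup>2 - 2 * j * k - a * b * j) * g (y k)" for k
    proof -
      have "half_char b (a * j\<^sup>2 - 2 * j * k - a * b * j) = half_char b (a * j\<^sup>2) * half_char b (- 2 * j * k - a * b * j)"
        unfolding half_char_add[symmetric] by (simp add: algebra_simps)
      moreover have "half_char b (- 2 * j * k - a * b * j) = cis (- 2 * pi * (s * of_int j / of_int b) * y k)"
        using assms(2,3) unfolding half_char_def y_def \<theta>_def
        by (intro arg_cong[where f = cis]) (simp add: field_simps)
      ultimately show ?thesis by (simp add: G)
    qed
    have "(\<Sum>\<^sub>\<infinity>m. f (j + b * m)) = half_char b (a * j\<^sup>2) * (\<Sum>\<^sub>\<infinity>m::int. cis (2 * pi * \<theta> * of_int m) * fourier G (s * of_int m))"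
      unfolding f_def char shift by (simp add: mult.assoc infsum_cmult_right')
    also have "\<dots> = half_char b (a * j\<^sup>2) * (1 / s * (\<Sum>\<^sub>\<infinity>k::int. G (y k)))"
      unfolding poisson_summation_twisted[OF \<open>decaying_C2 G\<close> assms(3)] y_def ..
    also have "\<dots> = 1 / s * (half_char b (a * j\<^sup>2) * (\<Sum>\<^sub>\<infinity>k::int. G (y k)))"
      by simp
    also have "\<dots> = (\<Sum>\<^sub>\<infinity>k::int. 1 / s * (half_char b (a * j\<^sup>2 - 2 * j * k - a * b * j) * g (y k)))"
      unfolding infsum_cmult_right'[symmetric] summand ..
    finally show "(\<Sum>\<^sub>\<infinity>m. f (j + b * m)) =
        (\<Sum>\<^sub>\<infinity>k::int. 1 / s * (half_char b (a * j\<^sup>2 - 2 * j * k - a * b * j) * g (y k)))" .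
  qed
  also have "\<dots> = (\<Sum>\<^sub>\<infinity>k::int. \<Sum>j\<in>{0..<\<bar>b\<bar>}. 1 / s * (half_char b (a * j\<^sup>2 - 2 * j * k - a * b * j) * g (y k)))"
  proof (rule infsum_sum_swap)
    fix j :: int
    have "(\<lambda>k::int. norm (g (y k))) summable_on UNIV"
      unfolding y_def using decaying_C2_quad_decay[OF gC2] assms(3)
      by (intro quad_decay_summable[OF quad_decay_affine]) auto
    then have "(\<lambda>k::int. norm (half_char b (a * j\<^sup>2 - 2 * j * k - a * b * j) * g (y k))) summable_on UNIV"
      by (simp add: norm_mult)
    then show "(\<lambda>k::int. 1 / s * (half_char b (a * j\<^sup>2 - 2 * j * k - a * b * j) * g (y k))) summable_on UNIV"
      by (rule summable_on_cmult_right[OF abs_summable_summable])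
  qed simp
  also have "\<dots> = (\<Sum>\<^sub>\<infinity>k::int. 1 / s * (chirp_gauss_sum a b k * g (y k)))"
    by (simp only: chirp_gauss_sum_def sum_distrib_left sum_distrib_right)
  also have "\<dots> = 1 / s * (\<Sum>\<^sub>\<infinity>k::int. chirp_gauss_sum a b k * g (y k))"
    by (rule infsum_cmult_right')
  finally show ?thesis unfolding f_def y_def \<theta>_def .
qed

text \<open>
  The relation \<open>a d - b c = 1\<close> gives \<open>a / (b r\<^sup>2) + t = d s\<^sup>2 / b\<close>. The two quadratic phases in \<open>y k\<close>
  then differ by \<open>d (s y)\<^sup>2 / b = d (k + \<theta>)\<^sup>2 / b\<close>, which cancels the denominators \<open>b\<close> in the phase of the
  Gauss sum. The terms that are left agree up to a constant and \<open>\<pi>\<close> times the even number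
  \<open>c d k (k + 1)\<close>.
\<close>

lemma half_char_completed_square:
  fixes a b c d :: int and r s t :: real
  assumes "r > 0" "s > 0" "b \<noteq> 0" "a * d - b * c = 1"
    and s2: "s\<^sup>2 = (of_int a)\<^sup>2 / r\<^sup>2 + (of_int b)\<^sup>2 * r\<^sup>2"
    and t: "t = of_int (a * c) / r\<^sup>2 + of_int (b * d) * r\<^sup>2"
  defines "\<theta> \<equiv> real_of_int (a * b) / 2"
  defines "y \<equiv> \<lambda>k::int. (of_int k + \<theta>) / s"
  shows "half_char b (d * (b * c - 1) * k\<^sup>2 - a * b * d * k) * cis (pi * of_int a / (of_int b * r\<^sup>2) * (y k)\<^sup>2) =
     cis (pi * of_int (c * d) * \<theta> + pi * of_int d * \<theta>\<^sup>2 / of_int b) *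
       cis (- (pi * t * (y k)\<^sup>2) - pi * (of_int (c * d) * s * y k))"
proof -
  have ad: "real_of_int a * of_int d = 1 + of_int b * of_int c"
    using assms(4) by (metis add.commute diff_add_cancel of_int_1 of_int_add of_int_mult)
  have coeff: "of_int a / (of_int b * r\<^sup>2) + t = of_int d * s\<^sup>2 / of_int b"
  proof -
    have "of_int b * r\<^sup>2 * (of_int a / (of_int b * r\<^sup>2) + t) = of_int a * (1 + of_int b * of_int c) + (of_int b)\<^sup>2 * of_int d * r\<^sup>2 * r\<^sup>2"
      unfolding t using assms(1,3) by (simp add: field_simps power2_eq_square)
    also have "\<dots> = of_int b * r\<^sup>2 * (of_int d * s\<^sup>2 / of_int b)"
      unfolding s2 ad[symmetric] using assms(1,3) by (simp add: field_simps power2_eq_square)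
    finally show ?thesis
      by (rule mult_left_cancel[THEN iffD1, rotated]) (use assms(1,3) in simp)
  qed
  have sy: "s * y k = of_int k + \<theta>" using assms(2) by (simp add: y_def)
  define n where "n = c * d * (k * (k + 1)) div 2"
  have n: "c * d * (k * (k + 1)) = 2 * n" by (simp add: n_def)
  have 1: "pi * of_int a / (of_int b * r\<^sup>2) * (y k)\<^sup>2 =
    pi * of_int d / of_int b * (of_int k + \<theta>)\<^sup>2 - pi * t * (y k)\<^sup>2"
  proof -
    have "pi * of_int a / (of_int b * r\<^sup>2) * (y k)\<^sup>2 = pi * ((of_int a / (of_int b * r\<^sup>2) + t) * (y k)\<^sup>2) - pi * t * (y k)\<^sup>2"
      by (simp add: algebra_simps)
    also have "(of_int a / (of_int b * r\<^sup>2) + t) * (y k)\<^sup>2 = of_int d / of_int b * (s * y k)\<^sup>2"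
      unfolding coeff by (simp add: power_mult_distrib)
    finally show ?thesis unfolding sy by simp
  qed
  have 2: "pi * of_int (d * (b * c - 1) * k\<^sup>2 - a * b * d * k) / of_int b + pi * of_int d / of_int b * (of_int k + \<theta>)\<^sup>2 =
    2 * pi * of_int n + (pi * of_int (c * d) * \<theta> + pi * of_int d * \<theta>\<^sup>2 / of_int b - pi * (of_int (c * d) * (of_int k + \<theta>)))"
  proof -
    have nn: "2 * real_of_int n = of_int c * of_int d * (of_int k * (of_int k + 1))"
      using arg_cong[OF n, of real_of_int] by (simp only: of_int_mult of_int_add of_int_1 of_int_numeral)
    have "2 * pi * of_int n = pi * (of_int c * of_int d * (of_int k * (of_int k + 1)))"
      unfolding nn[symmetric] by simp
    then show ?thesis
      using assms(3) by (simp add: \<theta>_def power2_eq_square field_simps)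
  qed
  have "half_char b (d * (b * c - 1) * k\<^sup>2 - a * b * d * k) * cis (pi * of_int a / (of_int b * r\<^sup>2) * (y k)\<^sup>2) =
    cis (2 * pi * of_int n + ((pi * of_int (c * d) * \<theta> + pi * of_int d * \<theta>\<^sup>2 / of_int b) +
       (- (pi * t * (y k)\<^sup>2) - pi * (of_int (c * d) * s * y k))))"
    unfolding half_char_def cis_mult 1 using 2
    by (intro arg_cong[where f = cis]) (simp add: sy mult.assoc)
  then show ?thesis
    unfolding cis_mult[symmetric] cis_2pi_int by simp
qed

lemma frft_comb_sin_nonzero:
  fixes \<alpha> r s t :: real and a b c d :: int
  assumes "r > 0" "s > 0" "b \<noteq> 0" "a * d - b * c = 1"
    and cs: "cos (pi * \<alpha> / 2) = of_int a / (r * s)" "sin (pi * \<alpha> / 2) = of_int b * r / s"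
    and s2: "s\<^sup>2 = (of_int a)\<^sup>2 / r\<^sup>2 + (of_int b)\<^sup>2 * r\<^sup>2"
    and t: "t = of_int (a * c) / r\<^sup>2 + of_int (b * d) * r\<^sup>2"
  defines "y \<equiv> \<lambda>k::int. (of_int k + of_int (a * b) / 2) / s"
  shows "\<exists>\<mu>. \<mu> \<noteq> 0 \<and> (\<forall>\<phi>\<in>schwartz. frft_dist \<alpha> (dirac_comb r) \<phi> =
     of_real (sqrt (1 / s)) * \<mu> * (\<Sum>\<^sub>\<infinity>k::int. cis (- (pi * t * (y k)\<^sup>2) - pi * (of_int (c * d) * s * y k)) * \<phi> (y k)))"
proof -
  define \<theta> :: real where "\<theta> = of_int (a * b) / 2"
  define \<kappa> where "\<kappa> = cis (pi * of_int (c * d) * \<theta> + pi * of_int d * \<theta>\<^sup>2 / of_int b)"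
  define p where "p = pi * of_int a / (of_int b * r\<^sup>2)"
  have "sin (pi * \<alpha> / 2) \<noteq> 0" using assms(1-3) by (simp add: cs)
  then obtain C where C: "C \<noteq> 0" "\<And>\<phi> x. frft \<alpha> \<phi> x = C * (LBINT y. frft_kernel \<alpha> x y * \<phi> y)"
    using frft_integral_formula by blast
  define \<mu> where "\<mu> = of_real (sqrt r) * C * (1 / s) * chirp_gauss_sum a b 0 * \<kappa> / of_real (sqrt (1 / s))"
  have "\<mu> \<noteq> 0"
    using assms(1,2) C(1) chirp_gauss_sum_nonzero[OF assms(3,4)] by (simp add: \<mu>_def \<kappa>_def)
  moreover have "frft_dist \<alpha> (dirac_comb r) \<phi> =
     of_real (sqrt (1 / s)) * \<mu> * (\<Sum>\<^sub>\<infinity>k::int. cis (- (pi * t * (y k)\<^sup>2) - pi * (of_int (c * d) * s * y k)) * \<phi> (y k))"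
    (is "_ = _ * \<mu> * infsum ?E _") if \<phi>: "\<phi> \<in> schwartz" for \<phi>
  proof -
    define g where "g x = cis (p * x\<^sup>2) * \<phi> x" for x
    have "frft \<alpha> \<phi> (r * of_int n) = C * (half_char b (a * n\<^sup>2) * fourier g (s * of_int n / of_int b))" for n
    proof -
      have "(LBINT y. frft_kernel \<alpha> (r * of_int n) y * \<phi> y) =
        (LBINT y. half_char b (a * n\<^sup>2) * (cis (- 2 * pi * (s * of_int n / of_int b) * y) * g y))"
        unfolding frft_kernel_lattice[OF assms(1-3) cs] g_def p_def by (simp only: mult.assoc)
      then show ?thesis by (simp only: C(2) fourier_def integral_mult_right_zero)
    qed
    then have "frft_dist \<alpha> (dirac_comb r) \<phi> =
       of_real (sqrt r) * (C * (\<Sum>\<^sub>\<infinity>n::int. half_char b (a * n\<^sup>2) * fourier g (s * of_int n / of_int b)))"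
      by (simp add: frft_dist_def dirac_comb_def delta_def infsum_cmult_right')
    also have "(\<Sum>\<^sub>\<infinity>n::int. half_char b (a * n\<^sup>2) * fourier g (s * of_int n / of_int b)) =
       1 / s * (\<Sum>\<^sub>\<infinity>k::int. chirp_gauss_sum a b k * g (y k))"
      unfolding g_def y_def by (rule sum_chirp_fourier[OF \<phi> assms(3,2)])
    also have "(\<Sum>\<^sub>\<infinity>k::int. chirp_gauss_sum a b k * g (y k)) = (\<Sum>\<^sub>\<infinity>k::int. (chirp_gauss_sum a b 0 * \<kappa>) * ?E k)"
    proof (rule infsum_cong)
      fix k :: int
      have square: "half_char b (d * (b * c - 1) * k\<^sup>2 - a * b * d * k) * cis (p * (y k)\<^sup>2) =
        \<kappa> * cis (- (pi * t * (y k)\<^sup>2) - pi * (of_int (c * d) * s * y k))"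
        using half_char_completed_square[OF assms(1-4) s2 t, of k] by (simp only: y_def \<kappa>_def \<theta>_def p_def)
      have "chirp_gauss_sum a b k * g (y k) = chirp_gauss_sum a b 0 *
        (half_char b (d * (b * c - 1) * k\<^sup>2 - a * b * d * k) * cis (p * (y k)\<^sup>2)) * \<phi> (y k)"
        unfolding chirp_gauss_sum_eq[OF assms(3,4), of k] by (simp only: g_def mult.assoc)
      also have "\<dots> = (chirp_gauss_sum a b 0 * \<kappa>) * ?E k"
        unfolding square by (simp only: mult.assoc)
      finally show "chirp_gauss_sum a b k * g (y k) = (chirp_gauss_sum a b 0 * \<kappa>) * ?E k" .
    qed
    also have "\<dots> = (chirp_gauss_sum a b 0 * \<kappa>) * infsum ?E UNIV"
      by (rule infsum_cmult_right')
    finally show ?thesis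
      using assms(2) by (simp add: \<mu>_def)
  qed
  ultimately show ?thesis by blast
qed

text \<open>
  Here \<open>a = d\<close> is a sign, \<open>s = 1 / r\<close>, and the lattice is mapped to itself by reflection. The phase at
  the \<open>k\<close>-th lattice point is \<open>- \<pi> c d k (k + 1)\<close>, a multiple of \<open>2 \<pi>\<close>.
\<close>

lemma frft_comb_sin_zero:
  fixes \<alpha> r s t :: real and a c d :: int
  assumes "r > 0" "s > 0" "a * d = 1"
    and sin0: "sin (pi * \<alpha> / 2) = 0"
    and s2: "s\<^sup>2 = (of_int a)\<^sup>2 / r\<^sup>2"
    and t: "t = of_int (a * c) / r\<^sup>2"
  defines "y \<equiv> \<lambda>k::int. of_int k / s"
  shows "\<exists>\<mu>. \<mu> \<noteq> 0 \<and> (\<forall>\<phi>\<in>schwartz. frft_dist \<alpha> (dirac_comb r) \<phi> =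
     of_real (sqrt (1 / s)) * \<mu> * (\<Sum>\<^sub>\<infinity>k::int. cis (- (pi * t * (y k)\<^sup>2) - pi * (of_int (c * d) * s * y k)) * \<phi> (y k)))"
proof -
  have ad: "a = d" "a\<^sup>2 = 1" using assms(3) by (auto simp: zmult_eq_1_iff)
  have "s\<^sup>2 = (1 / r)\<^sup>2" using s2 ad(2) by (simp add: power_divide flip: of_int_power)
  then have s: "s = 1 / r" using assms(1,2) by (simp add: power2_eq_iff_nonneg)
  obtain m :: int where "pi * \<alpha> / 2 = of_int m * pi"
    using sin0 by (auto simp: sin_zero_iff_int2)
  then have \<alpha>: "\<alpha> = 0 + 2 * of_int m" by simp
  define \<mu> where "\<mu> = exp (- (\<i> * of_real pi / 2 * of_int m))"
  have fr: "frft \<alpha> \<phi> x = \<mu> * \<phi> ((- 1) powi m * x)" for \<phi> x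
    unfolding \<alpha> by (subst frft_add_even) (simp_all add: frft_eq_base frft_base_def \<mu>_def)
  have phase: "cis (- (pi * t * (y k)\<^sup>2) - pi * (of_int (c * d) * s * y k)) = 1" for k
  proof -
    define n where "n = - (c * d * (k * (k + 1)) div 2)"
    have n: "c * d * (k * (k + 1)) = - 2 * n" by (simp add: n_def)
    have nn: "- 2 * real_of_int n = of_int c * of_int d * (of_int k * (of_int k + 1))"
      using arg_cong[OF n, of real_of_int] by (simp only: of_int_mult of_int_add of_int_1 of_int_minus of_int_numeral)
    have "- (pi * t * (y k)\<^sup>2) - pi * (of_int (c * d) * s * y k) = - pi * (of_int c * of_int d * (of_int k * (of_int k + 1)))"
      using assms(1) unfolding t y_def s ad(1) by (simp add: field_simps power2_eq_square)
    also have "\<dots> = 2 * pi * of_int n" unfolding nn[symmetric] by simp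
    finally show ?thesis by (simp only: cis_2pi_int)
  qed
  have "frft_dist \<alpha> (dirac_comb r) \<phi> = of_real (sqrt r) * \<mu> * (\<Sum>\<^sub>\<infinity>k::int. \<phi> (r * of_int k))" for \<phi>
  proof -
    have "(\<Sum>\<^sub>\<infinity>k::int. \<phi> ((- 1) powi m * (r * of_int k))) = (\<Sum>\<^sub>\<infinity>k::int. \<phi> (r * of_int k))"
    proof (cases "even m")
      case False
      then have "(\<Sum>\<^sub>\<infinity>k::int. \<phi> ((- 1) powi m * (r * of_int k))) = (\<Sum>\<^sub>\<infinity>k::int. \<phi> (r * of_int (- k)))"
        by simp
      also have "\<dots> = (\<Sum>\<^sub>\<infinity>k::int. \<phi> (r * of_int k))"
        by (rule infsum_reindex_bij_witness[of _ uminus uminus]) auto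
      finally show ?thesis .
    qed simp
    then show ?thesis by (simp add: frft_dist_def dirac_comb_def delta_def fr infsum_cmult_right')
  qed
  then have "frft_dist \<alpha> (dirac_comb r) \<phi> =
     of_real (sqrt (1 / s)) * \<mu> * (\<Sum>\<^sub>\<infinity>k::int. cis (- (pi * t * (y k)\<^sup>2) - pi * (of_int (c * d) * s * y k)) * \<phi> (y k))" for \<phi>
    unfolding phase by (simp add: y_def s mult.commute)
  then show ?thesis by (intro exI[of _ \<mu>]) (simp add: \<mu>_def)
qed

theorem theorem1p3:
  fixes \<alpha> r s t :: real and a b c d :: int
  assumes "r > 0" and "s > 0"
    and "coprime a b"
    and "exp (complex_of_real pi * \<i> / 2 * complex_of_real \<alpha>) =
           1 / complex_of_real s *
             (of_int a / complex_of_real r + \<i> * of_int b * complex_of_real r)"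
    and "a * d - b * c = 1"
    and "t = of_int (a * c) / r\<^sup>2 + of_int (b * d) * r\<^sup>2"
  shows "\<exists>\<mu>\<^sub>0::complex. \<mu>\<^sub>0 \<noteq> 0 \<and>
    tempered_eq
      (frft_dist \<alpha> (dirac_comb r))
      (mult_dist
        (\<lambda>x. \<mu>\<^sub>0 * exp (- complex_of_real pi * \<i> * complex_of_real (t * x\<^sup>2)
                       - complex_of_real pi * \<i> * complex_of_real (of_int (c * d) * s * x)))
        (translate_dist (of_int (a * b) / (2 * s)) (dirac_comb (1 / s))))"
proof -
  note angle = angle_components[OF assms(1,2,4)]
  define y where "y k = (of_int k + of_int (a * b) / 2) / s" for k :: int
  define w where "w k = cis (- (pi * t * (y k)\<^sup>2) - pi * (of_int (c * d) * s * y k))" for k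
  define R where "R \<mu> = mult_dist
        (\<lambda>x. \<mu> * exp (- complex_of_real pi * \<i> * complex_of_real (t * x\<^sup>2)
                       - complex_of_real pi * \<i> * complex_of_real (of_int (c * d) * s * x)))
        (translate_dist (of_int (a * b) / (2 * s)) (dirac_comb (1 / s)))" for \<mu> :: complex
  have "\<exists>\<mu>. \<mu> \<noteq> 0 \<and> (\<forall>\<phi>\<in>schwartz. frft_dist \<alpha> (dirac_comb r) \<phi> =
     of_real (sqrt (1 / s)) * \<mu> * (\<Sum>\<^sub>\<infinity>k::int. w k * \<phi> (y k)))"
  proof (cases "b = 0")
    case True
    then show ?thesis
      using frft_comb_sin_zero[of r s a d \<alpha> t c] assms angle by (simp add: w_def y_def)
  next
    case False
    then show ?thesis
      unfolding w_def y_def by (rule frft_comb_sin_nonzero[OF assms(1,2) _ assms(5) angle assms(6)])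
  qed
  then obtain \<mu> where \<mu>: "\<mu> \<noteq> 0" and eq: "\<And>\<phi>. \<phi> \<in> schwartz \<Longrightarrow>
      frft_dist \<alpha> (dirac_comb r) \<phi> = of_real (sqrt (1 / s)) * \<mu> * (\<Sum>\<^sub>\<infinity>k::int. w k * \<phi> (y k))"
    by blast
  have R: "R \<mu> = (\<lambda>\<phi>. of_real (sqrt (1 / s)) * \<mu> * (\<Sum>\<^sub>\<infinity>k::int. w k * \<phi> (y k)))"
  proof
    fix \<phi> :: "real \<Rightarrow> complex"
    have pos: "1 / s * of_int k + of_int (a * b) / (2 * s) = y k" for k
      by (simp add: y_def add_divide_distrib)
    have "exp (- complex_of_real pi * \<i> * complex_of_real (t * (y k)\<^sup>2)
               - complex_of_real pi * \<i> * complex_of_real (of_int (c * d) * s * y k)) = w k" for k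
      unfolding w_def cis_conv_exp by (rule arg_cong[where f = exp]) (simp add: algebra_simps)
    then have "R \<mu> \<phi> = of_real (sqrt (1 / s)) * (\<Sum>\<^sub>\<infinity>k::int. \<mu> * (w k * \<phi> (y k)))"
      unfolding R_def mult_dist_def translate_dist_def dirac_comb_def delta_def pos by (simp only: mult.assoc)
    then show "R \<mu> \<phi> = of_real (sqrt (1 / s)) * \<mu> * (\<Sum>\<^sub>\<infinity>k::int. w k * \<phi> (y k))"
      by (simp only: infsum_cmult_right' mult.assoc)
  qed
  have "tempered_distribution (R \<mu>)"
    unfolding R y_def by (rule tempered_distribution_lattice_sum[OF assms(2)]) (simp add: w_def)
  moreover from this have "tempered_distribution (frft_dist \<alpha> (dirac_comb r))"
    by (rule tempered_distribution_cong) (simp add: eq R)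
  ultimately have "tempered_eq (frft_dist \<alpha> (dirac_comb r)) (R \<mu>)"
    unfolding tempered_eq_def by (simp add: eq R)
  with \<mu> show ?thesis unfolding R_def by blast
qed

end
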